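(* Let $n\in\mathbb N$ and let $\varepsilon,\varepsilon'\in M_n(\{0,1\})$ be symmetric matrices with zero diagonal. (1) If $\varepsilon\neq\varepsilon_{\mathrm{comm}}$, then the $C^*$-algebra $C(S_{\mathbb R,\varepsilon}^{n-1})$ is noncommutative. (2) If $\varepsilon\neq\varepsilon'$, then $S_{\mathbb R,\varepsilon}^{n-1}\neq S_{\mathbb R,\varepsilon'}^{n-1}$, i.e. there is no $*$-isomorphism $C(S_{\mathbb R,\varepsilon}^{n-1})\to C(S_{\mathbb R,\varepsilon'}^{n-1})$ mapping $x_i\mapsto x_i$ for all $i$. (3) In particular, if $\varepsilon\neq\varepsilon_{\mathrm{comm}}$ and $\varepsilon\neq\varepsilon_{\mathrm{free}}$, then $S_{\mathbb R}^{n-1}\subsetneq S_{\mathbb R,\varepsilon}^{n-1}\subsetneq S_{\mathbb R,+}^{n-1}$, i.e. there are surjective but non-injective $*$-homomorphisms $$C(S_{\mathbb R,+}^{n-1})\to C(S_{\mathbb R,\varepsilon}^{n-1})\to C(S_{\mathbb R}^{n-1})$$ each sending $x_i\mapsto x_i$ for all $i$.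
   Context: For a symmetric matrix $\varepsilon=(\varepsilon_{ij})\in M_n(\{0,1\})$ with $\varepsilon_{ii}=0$ for all $i$, the $\varepsilon$-sphere $S_{\mathbb R,\varepsilon}^{n-1}$ is the noncommutative compact space defined via the universal unital $C^*$-algebra $$C(S_{\mathbb R,\varepsilon}^{n-1})=C^*\Big(x_1,\dots,x_n\;\Big|\; x_i=x_i^*,\ \sum_i x_i^2=1,\ x_ix_j=x_jx_i\text{ if }\varepsilon_{ij}=1\Big).$$ The matrix $\varepsilon_{\mathrm{comm}}$ has $\varepsilon_{ij}=1$ for all $i\ne j$ and $\varepsilon_{ii}=0$; the matrix $\varepsilon_{\mathrm{free}}$ has all entries $0$. The free sphere $S_{\mathbb R,+}^{n-1}$ is given by $C(S_{\mathbb R,+}^{n-1})=C^*(x_1,\dots,x_n\mid x_i=x_i^*,\ \sum_i x_i^2=1)$ (the case $\varepsilon_{\mathrm{free}}$), and $C(S_{\mathbb R}^{n-1})=C^*(x_1,\dots,x_n\mid x_i=x_i^*,\ \sum_i x_i^2=1,\ x_ix_j=x_jx_i\ \forall i,j)$ is the algebra of continuous functions on the usual real sphere (the case $\varepsilon_{\mathrm{comm}}$). *)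

theory Defs
  imports
    "HOL-Analysis.Analysis"
    "HOL-Algebra.Module"
    "HOL-Library.Poly_Mapping"
begin

text \<open>
  The universal unital \<open>C\<^sup>*\<close>-algebra on a family of generators subject to a set of *-polynomial
  relations is built in the usual way: the free unital complex *-algebra is equipped with the
  largest \<open>C\<^sup>*\<close>-seminorm that vanishes on the relations, and the universal \<open>C\<^sup>*\<close>-algebra is the
  Hausdorff completion for that seminorm.
\<close>

section \<open>The free unital *-algebra\<close>

datatype 'g letter = Gen 'g | Adj 'g

text \<open>A separate type, because lists are not an instance of \<^class>\<open>monoid_add\<close>, which
  \<^type>\<open>poly_mapping\<close> needs of its exponents: \<open>0\<close> is the empty word and \<open>+\<close> is concatenation.\<close>

datatype 'g monomial = Monomial (letters: "'g letter list")

instantiation monomial :: (type) monoid_add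
begin
definition "0 = Monomial []"
definition "v + w = Monomial (letters v @ letters w)"
instance
  by standard (simp_all add: zero_monomial_def plus_monomial_def)
end

type_synonym 'g free_alg = "'g monomial \<Rightarrow>\<^sub>0 complex"

definition gen :: "'g \<Rightarrow> 'g free_alg" where
  "gen i = Poly_Mapping.single (Monomial [Gen i]) 1"

definition fscale :: "complex \<Rightarrow> 'g free_alg \<Rightarrow> 'g free_alg" where
  "fscale c a = Poly_Mapping.single 0 c * a"

fun letter_star :: "'g letter \<Rightarrow> 'g letter" where
  "letter_star (Gen i) = Adj i"
| "letter_star (Adj i) = Gen i"

definition monomial_star :: "'g monomial \<Rightarrow> 'g monomial" where
  "monomial_star w = Monomial (rev (map letter_star (letters w)))"

definition fstar :: "'g free_alg \<Rightarrow> 'g free_alg" where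
  "fstar a = (\<Sum>w\<in>Poly_Mapping.keys a.
     Poly_Mapping.single (monomial_star w) (cnj (Poly_Mapping.lookup a w)))"

section \<open>The universal seminorm\<close>

definition cstar_seminorm :: "('g free_alg \<Rightarrow> real) \<Rightarrow> bool" where
  "cstar_seminorm p \<longleftrightarrow>
     (\<forall>a. 0 \<le> p a) \<and>
     (\<forall>a b. p (a + b) \<le> p a + p b) \<and>
     (\<forall>c a. p (fscale c a) = cmod c * p a) \<and>
     (\<forall>a b. p (a * b) \<le> p a * p b) \<and>
     (\<forall>a. p (fstar a) = p a) \<and>
     (\<forall>a. p (fstar a * a) = (p a)\<^sup>2)"

text \<open>A \<open>C\<^sup>*\<close>-seminorm that vanishes on the relations vanishes on the *-ideal they generate, so
  these are exactly the \<open>C\<^sup>*\<close>-seminorms of the *-algebra given by generators and relations.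
  The supremum is meaningful only if the relations bound the generators; for the sphere relations
  below, \<open>\<Sum>\<^sub>i x\<^sub>i\<^sup>2 = 1\<close> with self-adjoint \<open>x\<^sub>i\<close> gives \<open>p x\<^sub>i \<le> 1\<close>.\<close>

definition universal_seminorm :: "'g free_alg set \<Rightarrow> 'g free_alg \<Rightarrow> real" where
  "universal_seminorm R a = (SUP p\<in>{p. cstar_seminorm p \<and> (\<forall>r\<in>R. p r = 0)}. p a)"

section \<open>Hausdorff completion\<close>

definition seminorm_Cauchy :: "('g free_alg \<Rightarrow> real) \<Rightarrow> (nat \<Rightarrow> 'g free_alg) \<Rightarrow> bool" where
  "seminorm_Cauchy p X \<longleftrightarrow> (\<forall>e>0. \<exists>N. \<forall>k\<ge>N. \<forall>l\<ge>N. p (X k - X l) < e)"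

definition completion_rel ::
    "('g free_alg \<Rightarrow> real) \<Rightarrow> ((nat \<Rightarrow> 'g free_alg) \<times> (nat \<Rightarrow> 'g free_alg)) set" where
  "completion_rel p = {(X, Y). seminorm_Cauchy p X \<and> seminorm_Cauchy p Y \<and>
     (\<lambda>k. p (X k - Y k)) \<longlonglongrightarrow> 0}"

definition completion_class ::
    "('g free_alg \<Rightarrow> real) \<Rightarrow> (nat \<Rightarrow> 'g free_alg) \<Rightarrow> (nat \<Rightarrow> 'g free_alg) set" where
  "completion_class p X = completion_rel p `` {X}"

record 'a normed_star_algebra = "(complex, 'a) module" +
  star :: "'a \<Rightarrow> 'a"
  alg_norm :: "'a \<Rightarrow> real"

definition completion ::
    "('g free_alg \<Rightarrow> real) \<Rightarrow> (nat \<Rightarrow> 'g free_alg) set normed_star_algebra" where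
  "completion p =
    \<lparr> carrier = {X. seminorm_Cauchy p X} // completion_rel p,
      mult = (\<lambda>A B. \<Union>X\<in>A. \<Union>Y\<in>B. completion_class p (\<lambda>k. X k * Y k)),
      one = completion_class p (\<lambda>k. 1),
      zero = completion_class p (\<lambda>k. 0),
      add = (\<lambda>A B. \<Union>X\<in>A. \<Union>Y\<in>B. completion_class p (\<lambda>k. X k + Y k)),
      smult = (\<lambda>c A. \<Union>X\<in>A. completion_class p (\<lambda>k. fscale c (X k))),
      star = (\<lambda>A. \<Union>X\<in>A. completion_class p (\<lambda>k. fstar (X k))),
      alg_norm = (\<lambda>A. the_elem (\<Union>X\<in>A. {lim (\<lambda>k. p (X k))})) \<rparr>"

definition universal_cstar_algebra ::
    "'g free_alg set \<Rightarrow> (nat \<Rightarrow> 'g free_alg) set normed_star_algebra" where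
  "universal_cstar_algebra R = completion (universal_seminorm R)"

definition universal_gen :: "'g free_alg set \<Rightarrow> 'g \<Rightarrow> (nat \<Rightarrow> 'g free_alg) set" where
  "universal_gen R i = completion_class (universal_seminorm R) (\<lambda>k. gen i)"

section \<open>*-homomorphisms\<close>

text \<open>Preservation of the unit is not part of the definition; for the maps \<open>x\<^sub>i \<mapsto> x\<^sub>i\<close> between
  spheres it follows from \<open>\<Sum>\<^sub>i x\<^sub>i\<^sup>2 = 1\<close>.\<close>

definition star_hom ::
    "('a, 'x) normed_star_algebra_scheme \<Rightarrow> ('b, 'y) normed_star_algebra_scheme \<Rightarrow> ('a \<Rightarrow> 'b) set"
  where
  "star_hom A B = {\<phi>. \<phi> \<in> carrier A \<rightarrow> carrier B \<and>
     (\<forall>a\<in>carrier A. \<forall>b\<in>carrier A. \<phi> (a \<oplus>\<^bsub>A\<^esub> b) = \<phi> a \<oplus>\<^bsub>B\<^esub> \<phi> b) \<and>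
     (\<forall>a\<in>carrier A. \<forall>b\<in>carrier A. \<phi> (a \<otimes>\<^bsub>A\<^esub> b) = \<phi> a \<otimes>\<^bsub>B\<^esub> \<phi> b) \<and>
     (\<forall>c. \<forall>a\<in>carrier A. \<phi> (c \<odot>\<^bsub>A\<^esub> a) = c \<odot>\<^bsub>B\<^esub> \<phi> a) \<and>
     (\<forall>a\<in>carrier A. \<phi> (star A a) = star B (\<phi> a))}"

definition star_iso ::
    "('a, 'x) normed_star_algebra_scheme \<Rightarrow> ('b, 'y) normed_star_algebra_scheme \<Rightarrow> ('a \<Rightarrow> 'b) set"
  where
  "star_iso A B = {\<phi> \<in> star_hom A B. bij_betw \<phi> (carrier A) (carrier B)}"

definition commutative_alg :: "('a, 'x) normed_star_algebra_scheme \<Rightarrow> bool" where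
  "commutative_alg A \<longleftrightarrow> (\<forall>a\<in>carrier A. \<forall>b\<in>carrier A. a \<otimes>\<^bsub>A\<^esub> b = b \<otimes>\<^bsub>A\<^esub> a)"

section \<open>The spheres\<close>

text \<open>The index set \<open>{1, \<dots>, n}\<close> is a finite type \<open>'n\<close>.\<close>

definition eps_matrix :: "nat ^ 'n ^ 'n \<Rightarrow> bool" where
  "eps_matrix \<epsilon> \<longleftrightarrow>
     (\<forall>i j. \<epsilon> $ i $ j \<in> {0, 1}) \<and> (\<forall>i j. \<epsilon> $ i $ j = \<epsilon> $ j $ i) \<and> (\<forall>i. \<epsilon> $ i $ i = 0)"

definition eps_comm :: "nat ^ 'n ^ 'n" where
  "eps_comm = (\<chi> i j. if i = j then 0 else 1)"

definition eps_free :: "nat ^ 'n ^ 'n" where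
  "eps_free = (\<chi> i j. 0)"

definition sphere_relations :: "nat ^ 'n ^ 'n \<Rightarrow> 'n::finite free_alg set" where
  "sphere_relations \<epsilon> =
     {gen i - fstar (gen i) | i. True} \<union>
     {(\<Sum>i\<in>UNIV. gen i ^ 2) - 1} \<union>
     {gen i * gen j - gen j * gen i | i j. \<epsilon> $ i $ j = 1}"

definition C_sphere ::
    "nat ^ 'n ^ 'n \<Rightarrow> (nat \<Rightarrow> 'n::finite free_alg) set normed_star_algebra" where
  "C_sphere \<epsilon> = universal_cstar_algebra (sphere_relations \<epsilon>)"

definition sphere_gen :: "nat ^ 'n ^ 'n \<Rightarrow> 'n::finite \<Rightarrow> (nat \<Rightarrow> 'n free_alg) set" where
  "sphere_gen \<epsilon> i = universal_gen (sphere_relations \<epsilon>) i"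

end

theory Submission
  imports Defs
begin

text \<open>
  Only one representation is needed to separate the spheres: if \<open>\<epsilon>\<^sub>i\<^sub>j = 0\<close> with \<open>i \<noteq> j\<close>, sending
  \<open>x\<^sub>i, x\<^sub>j\<close> to two anticommuting Pauli matrices divided by \<open>\<surd>2\<close> and all other generators to \<open>0\<close>
  satisfies the relations, so \<open>[x\<^sub>i, x\<^sub>j] \<noteq> 0\<close> in \<open>C(S\<^sub>\<epsilon>)\<close>. This gives noncommutativity, the
  absence of isomorphisms, and non-injectivity of the quotient maps.

  That the universal seminorm is finite and that the quotient maps are onto is obtained without
  spectral theory. Finiteness: \<open>a = x\<^sub>i\<^sup>2\<close> and \<open>1 - a\<close> are sums
  of squares, hence \<open>p (1 + z a) \<le> 1 + |z| + O(|z|\<^sup>2)\<close> for every C*-seminorm \<open>p\<close>, and the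
  Bohnenblust--Karlin argument bounds \<open>p a\<close> by a universal constant. Surjectivity: an element that
  is small in the quotient is moved, by multiplication with the resolvent \<open>(1 + (a\<^sup>* a)\<^sup>2)\<^sup>-\<^sup>1\<close>, to
  one that is small upstairs, up to a much smaller error in the quotient; iterating lifts Cauchy
  sequences.
\<close>

section \<open>The free *-algebra\<close>

lemma free_alg_expansion: "(\<Sum>w\<in>Poly_Mapping.keys a. Poly_Mapping.single w (Poly_Mapping.lookup a w)) = a"
  by (rule poly_mapping_eqI)
    (auto simp: lookup_sum lookup_single when_def in_keys_iff sum.delta)

text \<open>Keeping the coefficient in the \<open>single\<close> case covers antilinear maps such as
  \<open>fstar\<close> as well as linear ones.\<close>

lemma free_alg_induct [case_names zero single add]:
  assumes "P 0" and "\<And>w c. P (Poly_Mapping.single w c)" and "\<And>a b. P a \<Longrightarrow> P b \<Longrightarrow> P (a + b)"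
  shows "P (a :: 'g free_alg)"
proof -
  have "P (\<Sum>w\<in>S. Poly_Mapping.single w (Poly_Mapping.lookup a w))" if "finite S" for S
    using that by induction (auto intro: assms)
  from this[OF finite_keys, of a] show ?thesis by (simp add: free_alg_expansion)
qed

lemma fscale_single [simp]:
  "fscale c (Poly_Mapping.single w d) = Poly_Mapping.single w (c * d)"
  by (simp add: fscale_def mult_single)

lemma fscale_add_right: "fscale c (a + b) = fscale c a + fscale c b"
  by (simp add: fscale_def distrib_left)

lemma fscale_zero_right [simp]: "fscale c 0 = 0"
  by (simp add: fscale_def)

lemma fscale_zero_left [simp]: "fscale 0 a = 0"
  by (simp add: fscale_def)

lemma fscale_one [simp]: "fscale 1 a = a"
  by (simp add: fscale_def)

lemma fscale_add_left: "fscale (c + d) a = fscale c a + fscale d a"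
  by (simp add: fscale_def single_add distrib_right)

lemma fscale_minus_left [simp]: "fscale (- c) a = - fscale c a"
  by (simp add: fscale_def single_uminus)

lemma fscale_diff_right: "fscale c (a - b) = fscale c a - fscale c b"
  by (simp add: fscale_def right_diff_distrib)

lemma fscale_minus_right [simp]: "fscale c (- a) = - fscale c a"
  by (simp add: fscale_def)

lemma fscale_fscale [simp]: "fscale c (fscale d a) = fscale (c * d) a"
  by (simp add: fscale_def mult.assoc[symmetric] mult_single)

lemma fscale_sum: "fscale c (sum f S) = (\<Sum>x\<in>S. fscale c (f x))"
  by (simp add: fscale_def sum_distrib_left)

lemma fscale_sum_left: "fscale (sum f S) a = (\<Sum>x\<in>S. fscale (f x) a)"
  by (induction S rule: infinite_finite_induct) (simp_all add: fscale_add_left)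

lemma fscale_mult_left [simp]: "fscale c a * b = fscale c (a * b)"
  by (simp add: fscale_def mult.assoc)

text \<open>Scalars sit on the empty word, which is neutral for concatenation on both sides.\<close>

lemma fscale_central: "a * Poly_Mapping.single 0 c = Poly_Mapping.single 0 c * (a :: 'g free_alg)"
  by (induction a rule: free_alg_induct) (simp_all add: mult_single algebra_simps)

lemma fscale_mult_right [simp]: "a * fscale c b = fscale c (a * b)"
  by (simp add: fscale_def mult.assoc[symmetric] fscale_central)

lemma fscale_of_nat: "fscale (of_nat k) a = of_nat k * a"
  by (simp add: fscale_def)

section \<open>The involution on words and on *-polynomials\<close>

lemma monomial_star_star [simp]: "monomial_star (monomial_star w) = (w :: 'g monomial)"
proof -
  have "letter_star (letter_star l) = l" for l :: "'g letter"
    by (cases l) simp_all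
  then show ?thesis by (cases w) (simp add: monomial_star_def rev_map comp_def map_idI)
qed

lemma monomial_star_add: "monomial_star (v + w) = monomial_star w + monomial_star v"
  by (simp add: monomial_star_def plus_monomial_def)

lemma monomial_star_zero [simp]: "monomial_star 0 = 0"
  by (simp add: monomial_star_def zero_monomial_def)

text \<open>\<open>monomial_star\<close> is its own inverse, so at most one key of \<open>a\<close>
  contributes to the coefficient at \<open>w\<close>.\<close>

lemma lookup_fstar:
  "Poly_Mapping.lookup (fstar a) w = cnj (Poly_Mapping.lookup a (monomial_star w))"
proof -
  have "monomial_star v = w \<longleftrightarrow> v = monomial_star w" for v
    by (metis monomial_star_star)
  then have "Poly_Mapping.lookup (fstar a) w =
      (\<Sum>v\<in>Poly_Mapping.keys a. if v = monomial_star w then cnj (Poly_Mapping.lookup a v) else 0)"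
    by (simp add: fstar_def lookup_sum lookup_single when_def)
  then show ?thesis
    by (auto simp: in_keys_iff)
qed

lemma fstar_single [simp]:
  "fstar (Poly_Mapping.single w c) = Poly_Mapping.single (monomial_star w) (cnj c)"
proof -
  have "w = monomial_star v \<longleftrightarrow> monomial_star w = v" for v
    by (metis monomial_star_star)
  then show ?thesis
    by (intro poly_mapping_eqI) (auto simp: lookup_fstar lookup_single when_def)
qed

lemma fstar_add: "fstar (a + b) = fstar a + fstar b"
  by (intro poly_mapping_eqI) (simp add: lookup_fstar lookup_add)

lemma fstar_diff: "fstar (a - b) = fstar a - fstar b"
  by (intro poly_mapping_eqI) (simp add: lookup_fstar lookup_minus)

lemma fstar_zero [simp]: "fstar 0 = 0"
  by (simp add: fstar_def)

lemma fstar_one [simp]: "fstar 1 = 1"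
  using fstar_single[of 0 1] by simp

lemma fstar_fstar [simp]: "fstar (fstar a) = a"
  by (intro poly_mapping_eqI) (simp add: lookup_fstar)

lemma fstar_mult: "fstar (a * b) = fstar b * fstar a"
proof (induction a rule: free_alg_induct)
  case (single w c)
  show ?case
    by (induction b rule: free_alg_induct)
      (simp_all add: mult_single monomial_star_add fstar_add algebra_simps)
qed (simp_all add: fstar_add algebra_simps)

lemma fstar_fscale [simp]: "fstar (fscale c a) = fscale (cnj c) (fstar a)"
  by (simp add: fscale_def fstar_mult fscale_central)

lemma fstar_sum: "fstar (sum f S) = (\<Sum>x\<in>S. fstar (f x))"
  by (induction S rule: infinite_finite_induct) (simp_all add: fstar_add)

lemma fstar_power: "fstar (a ^ k) = fstar a ^ k"
  by (induction k) (simp_all add: fstar_mult power_commutes)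

section \<open>C*-seminorms\<close>

locale cstar =
  fixes p :: "'g free_alg \<Rightarrow> real"
  assumes cstar_seminorm: "cstar_seminorm p"
begin

lemma nonneg [simp]: "0 \<le> p a"
  and triangle: "p (a + b) \<le> p a + p b"
  and scale [simp]: "p (fscale c a) = cmod c * p a"
  and submult: "p (a * b) \<le> p a * p b"
  and star [simp]: "p (fstar a) = p a"
  and cstar_identity: "p (fstar a * a) = (p a)\<^sup>2"
  using cstar_seminorm unfolding cstar_seminorm_def by blast+

lemma p_zero [simp]: "p 0 = 0"
  using scale[of 0 0] by simp

lemma p_minus [simp]: "p (- a) = p a"
  using scale[of "- 1" a] by simp

lemma p_minus_commute: "p (a - b) = p (b - a)"
  using p_minus[of "a - b"] by simp

lemma triangle_diff: "p (a - b) \<le> p a + p b"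
  using triangle[of a "- b"] by simp

lemma triangle_mid: "p (a - c) \<le> p (a - b) + p (b - c)"
  using triangle[of "a - b" "b - c"] by simp

lemma abs_diff_le: "\<bar>p a - p b\<bar> \<le> p (a - b)"
  using triangle[of "a - b" b] triangle[of "b - a" a] p_minus_commute[of a b] by simp

lemma p_sum_le: "p (sum f S) \<le> (\<Sum>x\<in>S. p (f x))"
proof (induction S rule: infinite_finite_induct)
  case (insert x S)
  then show ?case using triangle[of "f x" "sum f S"] by simp
qed simp_all

text \<open>The C*-identity at 1 reads \<open>p 1 = (p 1)\<^sup>2\<close>, so \<open>p 1\<close> is
  0 or 1; the value 0 occurs for the zero seminorm.\<close>

lemma p_one_le: "p 1 \<le> 1"
  using cstar_identity[of 1] by (auto simp: power2_eq_square)

lemma p_power_le: "p (a ^ k) \<le> p a ^ k"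
proof (induction k)
  case (Suc k)
  have "p (a ^ Suc k) \<le> p a * p (a ^ k)"
    using submult[of a "a ^ k"] by simp
  also have "\<dots> \<le> p a * p a ^ k"
    using Suc by (intro mult_left_mono) auto
  finally show ?case by simp
qed (simp add: p_one_le)

text \<open>This is how identities valid only modulo the relations enter the estimates.\<close>

lemma cong_p: "p (a - b) = 0 \<Longrightarrow> p a = p b"
  using abs_diff_le[of a b] by simp

lemma selfadjoint_square: "fstar h = h \<Longrightarrow> p (h * h) = (p h)\<^sup>2"
  using cstar_identity[of h] by simp

text \<open>With \<open>u = 1 - t h\<^sup>2 + i \<surd>(2t) h\<close> one has \<open>u\<^sup>* u = 1 + t\<^sup>2 h\<^sup>4\<close>, and the real part of \<open>u\<close>
  is \<open>1 - t h\<^sup>2\<close>.\<close>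

lemma one_minus_square_le:
  assumes h: "fstar h = h" and t: "0 \<le> t"
  shows "p (1 - fscale (of_real t) (h * h)) \<le> 1 + p h ^ 4 * t\<^sup>2"
proof -
  define s where "s = complex_of_real (sqrt (2 * t))"
  have ss: "s * s = of_real t + of_real t"
    using t unfolding s_def of_real_mult[symmetric] of_real_add[symmetric]
    by (simp add: abs_of_nonneg del: of_real_mult of_real_add)
  define y where "y = 1 - fscale (of_real t) (h * h)"
  define u where "u = y + fscale (\<i> * s) h"
  have ystar: "fstar y = y"
    by (simp add: y_def fstar_diff fstar_mult h)
  have ustar: "fstar u = y - fscale (\<i> * s) h"
    by (simp add: u_def fstar_add h ystar s_def)
  have yh: "y * h = h * y"
    by (simp add: y_def algebra_simps)
  have tt: "fscale (of_real t * 2) (h * h) = fscale (of_real t) (h * h) + fscale (of_real t) (h * h)"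
    by (simp only: mult_2_right fscale_add_left)
  have "fstar u * u = y * y - fscale (\<i> * s * (\<i> * s)) (h * h)"
    unfolding ustar unfolding u_def
    by (simp add: fscale_add_right fscale_diff_right algebra_simps yh)
  also have "\<i> * s * (\<i> * s) = - (s * s)"
    by (simp add: algebra_simps)
  also have "y * y - fscale (- (s * s)) (h * h) = 1 + fscale ((of_real t)\<^sup>2) (h * h * (h * h))"
    unfolding ss by (simp add: y_def tt algebra_simps power2_eq_square fscale_add_left fscale_diff_right)
  finally have "(p u)\<^sup>2 = p (1 + fscale ((of_real t)\<^sup>2) (h * h * (h * h)))"
    using cstar_identity[of u] by simp
  also have "\<dots> \<le> p 1 + t\<^sup>2 * p (h * h * (h * h))"
    using triangle[of 1 "fscale ((of_real t)\<^sup>2) (h * h * (h * h))"] by (simp add: norm_power)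
  also have "p (h * h * (h * h)) = p h ^ 4"
    using selfadjoint_square[of "h * h"] selfadjoint_square[of h] h by (simp add: fstar_mult)
  finally have 1: "(p u)\<^sup>2 \<le> 1 + p h ^ 4 * t\<^sup>2"
    using p_one_le by (simp add: mult.commute)
  have "p (fscale 2 y) = p (u + fstar u)"
    unfolding ustar unfolding u_def using fscale_add_left[of 1 1 y] by simp
  also have "\<dots> \<le> 2 * p u"
    using triangle[of u "fstar u"] by simp
  finally have "p y \<le> p u" by simp
  moreover have "p u \<le> 1 + p h ^ 4 * t\<^sup>2"
  proof (cases "p u \<le> 1")
    case True
    then show ?thesis by (smt (verit) zero_le_even_power even_numeral mult_nonneg_nonneg)
  next
    case False
    then have "p u \<le> (p u)\<^sup>2" by (simp add: power2_eq_square)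
    then show ?thesis using 1 by linarith
  qed
  ultimately show ?thesis by (simp add: y_def)
qed

text \<open>An order-free substitute for positivity: in a C*-algebra the self-adjoint elements with this
  property are exactly the positive ones.\<close>

definition quasi_pos :: "'g free_alg \<Rightarrow> bool" where
  "quasi_pos c \<longleftrightarrow> (\<exists>C\<ge>0. \<forall>t\<ge>0. p (1 - fscale (of_real t) c) \<le> 1 + C * t\<^sup>2)"

lemma quasi_pos_square: "fstar h = h \<Longrightarrow> quasi_pos (h * h)"
  unfolding quasi_pos_def using one_minus_square_le[of h] by (intro exI[of _ "p h ^ 4"]) simp

lemma quasi_pos_zero: "quasi_pos 0"
  unfolding quasi_pos_def using p_one_le by (intro exI[of _ 0]) simp

text \<open>\<open>1 - t (a + b)\<close> is the midpoint of \<open>1 - 2 t a\<close> and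
  \<open>1 - 2 t b\<close>. Doubling \<open>t\<close> quadruples the quadratic terms and averaging
  halves them, hence the constant \<open>2 * C + 2 * D\<close>.\<close>

lemma quasi_pos_add:
  assumes "quasi_pos a" and "quasi_pos b"
  shows "quasi_pos (a + b)"
proof -
  obtain C D where C: "C \<ge> 0" "\<And>t. t \<ge> 0 \<Longrightarrow> p (1 - fscale (of_real t) a) \<le> 1 + C * t\<^sup>2"
    and D: "D \<ge> 0" "\<And>t. t \<ge> 0 \<Longrightarrow> p (1 - fscale (of_real t) b) \<le> 1 + D * t\<^sup>2"
    using assms unfolding quasi_pos_def by blast
  have "p (1 - fscale (of_real t) (a + b)) \<le> 1 + (2 * C + 2 * D) * t\<^sup>2" if "t \<ge> 0" for t
  proof -
    have "fscale 2 (1 - fscale (of_real t) (a + b)) =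
        (1 - fscale (of_real (2 * t)) a) + (1 - fscale (of_real (2 * t)) b)"
      using fscale_add_left[of 1 1 "1 :: 'g free_alg"]
      by (simp add: fscale_diff_right fscale_add_right algebra_simps)
    then have "2 * p (1 - fscale (of_real t) (a + b)) \<le>
        p (1 - fscale (of_real (2 * t)) a) + p (1 - fscale (of_real (2 * t)) b)"
      using triangle scale[of 2 "1 - fscale (of_real t) (a + b)"] by (metis norm_numeral)
    also have "\<dots> \<le> (1 + C * (2 * t)\<^sup>2) + (1 + D * (2 * t)\<^sup>2)"
      using that by (intro add_mono C D) simp_all
    finally show ?thesis by (simp add: algebra_simps power2_eq_square)
  qed
  then show ?thesis
    unfolding quasi_pos_def using C(1) D(1) by (intro exI[of _ "2 * C + 2 * D"]) simp
qed

lemma quasi_pos_sum: "(\<And>i. i \<in> S \<Longrightarrow> quasi_pos (f i)) \<Longrightarrow> quasi_pos (sum f S)"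
  by (induction S rule: infinite_finite_induct) (simp_all add: quasi_pos_zero quasi_pos_add)

end

section \<open>Extraction of coefficients and the Bohnenblust--Karlin bound\<close>

text \<open>The sum is geometric in \<open>z = exp (2 pi i l / n)\<close>, where
  \<open>z ^ n = 1\<close>, and \<open>z = 1\<close> exactly if \<open>n\<close> divides
  \<open>l\<close>.\<close>

lemma sum_roots_of_unity_power:
  assumes "n \<ge> 1"
  shows "(\<Sum>j<n. (exp (2 * of_real pi * \<i> * of_nat j / of_nat n)) ^ l) = (if n dvd l then of_nat n else 0)"
proof -
  define z where "z = exp (2 * of_real pi * \<i> * of_nat l / of_nat n)"
  have z: "exp (2 * of_real pi * \<i> * of_nat j / of_nat n) ^ l = z ^ j" for j
    unfolding z_def exp_of_nat_mult[symmetric] by (simp add: algebra_simps)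
  have "z = 1 \<longleftrightarrow> n dvd l"
    unfolding z_def using complex_root_unity_eq_1 assms by blast
  moreover have "z ^ n = 1"
    unfolding z_def using complex_root_unity assms by (metis not_one_le_zero)
  ultimately show ?thesis
    using one_diff_power_eq[of z n] by (auto simp: z)
qed

text \<open>A binomial expansion whose coefficients are independent of \<open>c\<close>; only those
  of degree 0 and 1 are made explicit, the latter for \<open>linear_coefficient_le\<close>, the
  former to carry the induction.\<close>

lemma free_alg_power_expansion:
  "\<exists>Y. Y 0 = 1 \<and> Y (1 :: nat) = of_nat m * y \<and>
     (\<forall>c. (1 + fscale c y) ^ m = (\<Sum>k\<le>m. fscale (c ^ k) (Y k)))"
proof (induction m)
  case 0
  show ?case by (intro exI[of _ "\<lambda>k. if k = 0 then 1 else 0"]) simp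
next
  case (Suc m)
  then obtain Y where Y: "Y 0 = 1" "Y (1 :: nat) = of_nat m * y"
    and E: "\<And>c. (1 + fscale c y) ^ m = (\<Sum>k\<le>m. fscale (c ^ k) (Y k))" by blast
  \<comment> \<open>These are the coefficients after multiplication by \<open>1 + c y\<close>. The
    induction hypothesis says nothing about \<open>Y k\<close> beyond \<open>m\<close>, so
    \<open>Y\<close> is cut off there.\<close>
  define Z where "Z k = (if k \<le> m then Y k else 0) + (case k of 0 \<Rightarrow> 0 | Suc i \<Rightarrow> y * Y i)" for k
  have "(1 + fscale c y) ^ Suc m = (\<Sum>k\<le>Suc m. fscale (c ^ k) (Z k))" for c
  proof -
    have "(1 + fscale c y) ^ Suc m =
        (\<Sum>k\<le>m. fscale (c ^ k) (Y k)) + (\<Sum>k\<le>m. fscale (c ^ Suc k) (y * Y k))"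
      by (simp add: E distrib_right sum_distrib_left fscale_sum fscale_add_right sum.distrib mult.commute)
    also have "(\<Sum>k\<le>m. fscale (c ^ k) (Y k)) = (\<Sum>k\<le>Suc m. fscale (c ^ k) (if k \<le> m then Y k else 0))"
      by (simp add: sum.atMost_Suc)
    also have "(\<Sum>k\<le>m. fscale (c ^ Suc k) (y * Y k)) =
        (\<Sum>k\<le>Suc m. fscale (c ^ k) (case k of 0 \<Rightarrow> 0 | Suc i \<Rightarrow> y * Y i))"
      by (subst sum.atMost_Suc_shift) simp
    finally show ?thesis by (simp only: Z_def fscale_add_right sum.distrib)
  qed
  moreover have "Z 0 = 1" using Y by (simp add: Z_def)
  moreover have "Z 1 = of_nat (Suc m) * y"
  proof (cases "m = 0")
    case True
    then show ?thesis using Y by (simp add: Z_def)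
  next
    case False
    then show ?thesis using Y by (simp add: Z_def algebra_simps)
  qed
  ultimately show ?case by blast
qed

context cstar
begin

text \<open>Averaging \<open>\<omega>\<^sup>-\<^sup>1 (1 + \<omega> y)\<^sup>m\<close> over sufficiently many roots of unity \<open>\<omega>\<close> isolates the linear
  coefficient \<open>m y\<close>.\<close>

lemma linear_coefficient_le:
  assumes m: "m \<ge> 1" and B: "\<And>z. cmod z = 1 \<Longrightarrow> p (1 + fscale z y) \<le> B"
  shows "m * p y \<le> B ^ m"
proof -
  \<comment> \<open>With \<open>N = m + 1\<close> roots the factor \<open>w ^ m\<close> is the
    inverse of \<open>w\<close>, and among the exponents \<open>m + k\<close> with
    \<open>k \<le> m\<close> only \<open>m + 1\<close> is a multiple of \<open>N\<close>; so the
    average keeps just the term \<open>k = 1\<close>.\<close>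
  define N where "N = Suc m"
  define w where "w j = exp (2 * of_real pi * \<i> * of_nat j / of_nat N)" for j
  have wn: "cmod (w j) = 1" for j by (simp add: w_def)
  obtain Y where Y: "Y (1 :: nat) = of_nat m * y"
    and E: "\<And>c. (1 + fscale c y) ^ m = (\<Sum>k\<le>m. fscale (c ^ k) (Y k))"
    using free_alg_power_expansion[of m y] by blast
  have "(\<Sum>j<N. fscale (w j ^ m) ((1 + fscale (w j) y) ^ m)) =
      (\<Sum>k\<le>m. fscale (\<Sum>j<N. w j ^ (m + k)) (Y k))"
  proof -
    have "(\<Sum>j<N. fscale (w j ^ m) ((1 + fscale (w j) y) ^ m)) =
        (\<Sum>j<N. \<Sum>k\<le>m. fscale (w j ^ (m + k)) (Y k))"
      by (simp add: E fscale_sum power_add)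
    also have "\<dots> = (\<Sum>k\<le>m. \<Sum>j<N. fscale (w j ^ (m + k)) (Y k))"
      by (rule sum.swap)
    also have "\<dots> = (\<Sum>k\<le>m. fscale (\<Sum>j<N. w j ^ (m + k)) (Y k))"
      by (simp add: fscale_sum_left)
    finally show ?thesis .
  qed
  also have "\<dots> = (\<Sum>k\<le>m. if k = 1 then fscale (of_nat N) (of_nat m * y) else 0)"
  proof (rule sum.cong[OF refl])
    fix k assume "k \<in> {..m}"
    have "k = 1" if d: "N dvd m + k"
    proof -
      obtain q where q: "m + k = N * q" using d unfolding dvd_def by blast
      have "q \<noteq> 0" using q m by (intro notI) simp
      moreover have "\<not> 2 \<le> q"
      proof
        assume "2 \<le> q"
        then have "N * 2 \<le> N * q" by (intro mult_left_mono) auto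
        then show False using q \<open>k \<in> {..m}\<close> by (simp add: N_def)
      qed
      ultimately have "q = 1" by linarith
      then show ?thesis using q by (simp add: N_def)
    qed
    then have "N dvd m + k \<longleftrightarrow> k = 1"
      by (auto simp: N_def)
    then show "fscale (\<Sum>j<N. w j ^ (m + k)) (Y k) = (if k = 1 then fscale (of_nat N) (of_nat m * y) else 0)"
      using sum_roots_of_unity_power[of N "m + k"] Y by (auto simp: w_def N_def)
  qed
  also have "\<dots> = fscale (of_nat N * of_nat m) y"
    using m by (simp add: fscale_of_nat[symmetric])
  finally have "p (fscale (of_nat N * of_nat m) y) = p (\<Sum>j<N. fscale (w j ^ m) ((1 + fscale (w j) y) ^ m))"
    by simp
  also have "\<dots> \<le> (\<Sum>j<N. p (fscale (w j ^ m) ((1 + fscale (w j) y) ^ m)))"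
    by (rule p_sum_le)
  also have "\<dots> \<le> (\<Sum>j<N. B ^ m)"
  proof (rule sum_mono)
    fix j
    have "p ((1 + fscale (w j) y) ^ m) \<le> p (1 + fscale (w j) y) ^ m"
      by (rule p_power_le)
    also have "\<dots> \<le> B ^ m"
      using B[OF wn] by (intro power_mono) auto
    finally show "p (fscale (w j ^ m) ((1 + fscale (w j) y) ^ m)) \<le> B ^ m"
      by (simp add: norm_power wn)
  qed
  finally show ?thesis
    by (simp add: N_def norm_mult del: of_nat_Suc)
qed

text \<open>Let \<open>e = 1 + Re z a\<close> and \<open>u = e + i (Im z) a\<close>. Both parts are
  built from the self-adjoint \<open>a\<close> and commute, so the cross terms of
  \<open>fstar u * u\<close> cancel and leave \<open>e * e + (Im z)^2 a * a\<close>.\<close>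

lemma one_plus_scale_square_le:
  assumes a: "fstar a = a"
  shows "(p (1 + fscale z a))\<^sup>2 \<le> (p (1 + fscale (of_real (Re z)) a))\<^sup>2 + (Im z)\<^sup>2 * (p a)\<^sup>2"
proof -
  define e where "e = 1 + fscale (of_real (Re z)) a"
  define u where "u = e + fscale (\<i> * of_real (Im z)) a"
  have u: "1 + fscale z a = u"
    unfolding u_def e_def add.assoc fscale_add_left[symmetric] complex_eq[symmetric] ..
  have e: "fstar e = e" by (simp add: e_def fstar_add a)
  have us: "fstar u = e - fscale (\<i> * of_real (Im z)) a"
    by (simp add: u_def fstar_add e a)
  have "e * a = a * e" by (simp add: e_def algebra_simps)
  then have "fstar u * u = e * e + fscale (of_real ((Im z)\<^sup>2)) (a * a)"
    unfolding us unfolding u_def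
    by (simp add: fscale_add_right fscale_diff_right algebra_simps power2_eq_square)
  then have "(p u)\<^sup>2 \<le> p (e * e) + (Im z)\<^sup>2 * p (a * a)"
    using cstar_identity[of u] triangle[of "e * e" "fscale (of_real ((Im z)\<^sup>2)) (a * a)"]
    by (simp add: norm_power)
  then show ?thesis using selfadjoint_square e a by (simp add: u e_def)
qed

text \<open>The Bohnenblust--Karlin argument: \<open>p (1 + z a) \<le> 1 + |z| + O(|z|\<^sup>2)\<close> for all complex \<open>z\<close>, hence
  \<open>p a \<le> p (1 + z a)\<^sup>m\<close> for some \<open>|z| = 1/m\<close>, and the right-hand side stays bounded as \<open>m \<rightarrow> \<infinity>\<close>.\<close>

lemma numerical_bound:
  assumes a: "fstar a = a" and C: "0 \<le> C"
    and L: "\<And>t. \<bar>t\<bar> \<le> 1 \<Longrightarrow> p (1 + fscale (of_real t) a) \<le> 1 + \<bar>t\<bar> + C * t\<^sup>2"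
  shows "(p a)\<^sup>2 \<le> exp 9"
proof -
  \<comment> \<open>For \<open>s = 1 / m\<close> this choice makes both \<open>C * s\<close> and
    \<open>(p a)^2 * s\<close> at most 1, so every quadratic error term below is at most
    \<open>s\<close>.\<close>
  define m where "m = nat \<lceil>C + (p a)\<^sup>2\<rceil> + 1"
  have m1: "m \<ge> 1" and mC: "C \<le> m" and mK: "(p a)\<^sup>2 \<le> m"
  proof -
    have "C + (p a)\<^sup>2 \<le> real (nat \<lceil>C + (p a)\<^sup>2\<rceil>)" by linarith
    moreover have "real m = real (nat \<lceil>C + (p a)\<^sup>2\<rceil>) + 1" by (simp add: m_def)
    ultimately show "C \<le> m" "(p a)\<^sup>2 \<le> m" using C zero_le_power2[of "p a"] by linarith+
  qed (simp add: m_def)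
  define s where "s = 1 / real m"
  have s: "0 < s" "s \<le> 1" "C * s \<le> 1" "(p a)\<^sup>2 * s \<le> 1" "real m * s = 1"
    using m1 mC mK by (simp_all add: s_def field_simps)
  \<comment> \<open>The 9 comes from \<open>(1 + 2 s)^2 + s = 1 + 5 s + 4 s^2\<close> together with
    \<open>s \<le> 1\<close>.\<close>
  define B where "B = sqrt (1 + 9 * s)"
  have "p (1 + fscale z (fscale (of_real s) a)) \<le> B" if z: "cmod z = 1" for z
  proof -
    have re: "\<bar>Re z * s\<bar> \<le> s" and im: "\<bar>Im z * s\<bar> \<le> s"
      using z s abs_Re_le_cmod[of z] abs_Im_le_cmod[of z] by (auto simp: abs_mult mult_left_le_one_le)
    have re2: "(Re z * s)\<^sup>2 \<le> s\<^sup>2" and im2: "(Im z * s)\<^sup>2 \<le> s\<^sup>2"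
      using re im s by (auto simp: abs_le_square_iff[symmetric])
    have "p (1 + fscale (of_real (Re z * s)) a) \<le> 1 + \<bar>Re z * s\<bar> + C * (Re z * s)\<^sup>2"
      using re s by (intro L) linarith
    also have "\<dots> \<le> 1 + s + C * s\<^sup>2"
      using re re2 C by (intro add_mono mult_left_mono) auto
    also have "\<dots> \<le> 1 + 2 * s"
      using mult_right_mono[OF s(3), of s] s by (simp add: power2_eq_square mult.assoc)
    finally have 1: "(p (1 + fscale (of_real (Re z * s)) a))\<^sup>2 \<le> (1 + 2 * s)\<^sup>2"
      by (intro power_mono) auto
    have 2: "(Im z * s)\<^sup>2 * (p a)\<^sup>2 \<le> s"
    proof -
      have "(Im z * s)\<^sup>2 * (p a)\<^sup>2 \<le> s\<^sup>2 * (p a)\<^sup>2" using im2 by (intro mult_right_mono) auto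
      also have "\<dots> = s * ((p a)\<^sup>2 * s)" by (simp add: power2_eq_square)
      also have "\<dots> \<le> s * 1" using s by (intro mult_left_mono) auto
      finally show ?thesis by simp
    qed
    have "(p (1 + fscale (z * of_real s) a))\<^sup>2 \<le> (1 + 2 * s)\<^sup>2 + s"
      using one_plus_scale_square_le[OF a, of "z * of_real s"] 1 2 by simp
    also have "\<dots> \<le> 1 + 9 * s"
      using mult_left_mono[of s 1 s] s by (simp add: power2_eq_square algebra_simps)
    finally show ?thesis unfolding B_def by (simp add: real_le_rsqrt)
  qed
  \<comment> \<open>The element is \<open>y = s a\<close>, and \<open>m * s = 1\<close> turns
    \<open>m * p y\<close> into \<open>p a\<close>.\<close>
  from linear_coefficient_le[OF m1 this] have "p a \<le> B ^ m"
    using s m1 by (simp add: mult.assoc[symmetric])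
  then have "(p a)\<^sup>2 \<le> (B ^ m)\<^sup>2"
    by (intro power_mono) auto
  also have "\<dots> = (1 + 9 * s) ^ m"
    using s by (simp add: B_def power_mult[symmetric] mult.commute[of m]) (simp add: power_mult)
  also have "\<dots> \<le> exp (9 * s) ^ m"
    using s by (intro power_mono exp_ge_add_one_self) auto
  also have "\<dots> = exp 9"
    using s(5) by (simp add: exp_of_nat_mult[symmetric] mult.left_commute)
  finally show ?thesis .
qed

text \<open>Supplies the hypothesis of \<open>numerical_bound\<close> on both half-lines. For
  negative \<open>t\<close> it is quasi-positivity of \<open>a\<close>. For
  \<open>t \<ge> 0\<close>, modulo the kernel \<open>a\<close> is \<open>1 - b\<close>, and
  \<open>1 + t a\<close> becomes \<open>(1 + t) (1 - s b)\<close> with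
  \<open>s = t / (1 + t)\<close>, so quasi-positivity of \<open>b\<close> applies.\<close>

lemma quasi_pos_bound:
  assumes a: "fstar a = a" and "quasi_pos a" and "quasi_pos b" and ab: "p (a + b - 1) = 0"
  shows "(p a)\<^sup>2 \<le> exp 9"
proof -
  obtain C D where C: "C \<ge> 0" "\<And>t. t \<ge> 0 \<Longrightarrow> p (1 - fscale (of_real t) a) \<le> 1 + C * t\<^sup>2"
    and D: "D \<ge> 0" "\<And>t. t \<ge> 0 \<Longrightarrow> p (1 - fscale (of_real t) b) \<le> 1 + D * t\<^sup>2"
    using assms unfolding quasi_pos_def by blast
  show ?thesis
  proof (rule numerical_bound[OF a, of "C + 2 * D"])
    fix t :: real assume t: "\<bar>t\<bar> \<le> 1"
    show "p (1 + fscale (of_real t) a) \<le> 1 + \<bar>t\<bar> + (C + 2 * D) * t\<^sup>2"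
    proof (cases "t \<ge> 0")
      case False
      then have "p (1 + fscale (of_real t) a) \<le> 1 + C * t\<^sup>2"
        using C(2)[of "- t"] by simp
      also have "\<dots> \<le> 1 + \<bar>t\<bar> + (C + 2 * D) * t\<^sup>2"
        using D by (intro add_mono mult_right_mono) auto
      finally show ?thesis .
    next
      case True
      define s where "s = t / (1 + t)"
      have s: "0 \<le> s" "s \<le> t" "(1 + t) * s = t"
        using True t by (auto simp: s_def field_simps)
      have "1 + fscale (of_real t) a - fscale (of_real (1 + t)) (1 - fscale (of_real s) b) =
          fscale (of_real t) (a + b - 1)"
      proof -
        have "fscale (of_real (1 + t)) (fscale (of_real s) b) = fscale (of_real t) b"
          unfolding fscale_fscale of_real_mult[symmetric] s(3) ..
        moreover have "fscale (of_real (1 + t)) 1 = 1 + fscale (of_real t) (1 :: 'g free_alg)"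
          by (simp add: fscale_add_left)
        ultimately show ?thesis
          by (simp add: fscale_add_right fscale_diff_right del: fscale_fscale of_real_add)
      qed
      then have "p (1 + fscale (of_real t) a) = p (fscale (of_real (1 + t)) (1 - fscale (of_real s) b))"
        using ab by (intro cong_p) simp
      also have "\<dots> = (1 + t) * p (1 - fscale (of_real s) b)"
        using True by (simp add: abs_of_nonneg del: of_real_add of_real_1)
      also have "\<dots> \<le> (1 + t) * (1 + D * s\<^sup>2)"
        using True s D by (intro mult_left_mono) auto
      also have "\<dots> \<le> (1 + t) * (1 + D * t\<^sup>2)"
        using True s D by (intro mult_left_mono add_mono power_mono) auto
      also have "\<dots> = 1 + t + (1 + t) * (D * t\<^sup>2)" by (simp add: algebra_simps)
      also have "\<dots> \<le> 1 + t + 2 * (D * t\<^sup>2)"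
        using t D by (intro add_mono mult_right_mono) auto
      also have "\<dots> \<le> 1 + \<bar>t\<bar> + (C + 2 * D) * t\<^sup>2"
        using True mult_nonneg_nonneg[OF C(1) zero_le_power2[of t]] by (simp add: distrib_right)
      finally show ?thesis .
    qed
  qed (use C D in simp)
qed

end

section \<open>The universal seminorm of a sphere\<close>

text \<open>For nonzero \<open>c\<close> the reverse inequality is the assumed one for
  \<open>inverse c\<close> and the element \<open>fscale c a\<close>.\<close>

lemma scale_eqI:
  assumes "\<And>c a. U (fscale c a) \<le> cmod c * (U a :: real)" and "\<And>a. 0 \<le> U a"
  shows "U (fscale c a) = cmod c * U a"
proof (cases "c = 0")
  case True
  then show ?thesis using assms(1)[of c a] assms(2)[of "fscale c a"] by simp
next
  case False
  then have "cmod c * U a \<le> U (fscale c a)"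
    using assms(1)[of "inverse c" "fscale c a"] by (simp add: norm_inverse norm_divide field_simps)
  then show ?thesis using assms(1)[of c a] by linarith
qed

text \<open>Every axiom passes to a pointwise supremum. For the lower half of the C*-identity, each
  \<open>p a\<close> is at most the square root of the supremum at \<open>fstar a * a\<close>.
  Nonemptiness and boundedness make the real supremum meaningful.\<close>

lemma cstar_seminorm_SUP:
  assumes cs: "\<And>p. p \<in> Q \<Longrightarrow> cstar_seminorm p" and ne: "Q \<noteq> {}"
    and bdd: "\<And>a. bdd_above ((\<lambda>p. p a) ` Q)"
  shows "cstar_seminorm (\<lambda>a. SUP p\<in>Q. p a)"
proof -
  define U where "U = (\<lambda>a. SUP p\<in>Q. p a)"
  have le: "p a \<le> U a" if "p \<in> Q" for p a
    unfolding U_def using that by (intro cSUP_upper bdd)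
  have least: "U a \<le> B" if "\<And>p. p \<in> Q \<Longrightarrow> p a \<le> B" for a B
    unfolding U_def using that by (intro cSUP_least ne)
  have cst: "cstar p" if "p \<in> Q" for p
    using cs[OF that] by unfold_locales
  have nonneg: "0 \<le> U a" for a
  proof -
    obtain p where "p \<in> Q" using ne by blast
    then show ?thesis using le[of p a] cstar.nonneg[OF cst, of p a] by linarith
  qed
  have scale_le: "U (fscale c a) \<le> cmod c * U a" for c a
    by (rule least) (simp add: cstar.scale[OF cst] le mult_left_mono)
  show ?thesis
    unfolding cstar_seminorm_def U_def[symmetric]
  proof (intro conjI allI)
    fix a b c
    show "0 \<le> U a" by (rule nonneg)
    show "U (a + b) \<le> U a + U b"
    proof (rule least)
      fix p assume "p \<in> Q"
      then show "p (a + b) \<le> U a + U b"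
        using cstar.triangle[OF cst, of p a b] le[of p a] le[of p b] by linarith
    qed
    show "U (fscale c a) = cmod c * U a"
      by (rule scale_eqI[OF scale_le nonneg])
    show "U (a * b) \<le> U a * U b"
    proof (rule least)
      fix p assume p: "p \<in> Q"
      have "p (a * b) \<le> p a * p b" by (rule cstar.submult[OF cst[OF p]])
      also have "\<dots> \<le> U a * U b"
        using p by (intro mult_mono le nonneg cstar.nonneg[OF cst])
      finally show "p (a * b) \<le> U a * U b" .
    qed
    show "U (fstar a) = U a"
      unfolding U_def by (intro SUP_cong refl) (simp add: cstar.star[OF cst])
    show "U (fstar a * a) = (U a)\<^sup>2"
    proof (rule antisym)
      show "U (fstar a * a) \<le> (U a)\<^sup>2"
        by (rule least) (simp add: cstar.cstar_identity[OF cst] power_mono le cstar.nonneg[OF cst])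
      have "U a \<le> sqrt (U (fstar a * a))"
      proof (rule least)
        fix p assume p: "p \<in> Q"
        then have "(p a)\<^sup>2 \<le> U (fstar a * a)"
          using le[of p "fstar a * a"] cstar.cstar_identity[OF cst, of p a] by simp
        then show "p a \<le> sqrt (U (fstar a * a))" by (rule real_le_rsqrt)
      qed
      then have "(U a)\<^sup>2 \<le> (sqrt (U (fstar a * a)))\<^sup>2"
        by (intro power_mono nonneg)
      then show "(U a)\<^sup>2 \<le> U (fstar a * a)" by (simp add: nonneg)
    qed
  qed
qed

section \<open>Bounds uniform in the seminorm\<close>

lemma (in cstar) word_bound:
  assumes B: "1 \<le> B" and g: "\<And>i. p (gen i) \<le> B"
  shows "p (Poly_Mapping.single (Monomial ls) 1) \<le> B ^ length ls"
proof (induction ls)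
  case Nil
  then show ?case using p_one_le by (simp add: zero_monomial_def[symmetric])
next
  case (Cons l ls)
  have l: "p (Poly_Mapping.single (Monomial [l]) 1) \<le> B"
  proof (cases l)
    case (Gen i)
    then show ?thesis using g[of i] by (simp add: gen_def)
  next
    case (Adj i)
    then have "Poly_Mapping.single (Monomial [l]) 1 = fstar (gen i)"
      by (simp add: gen_def monomial_star_def)
    then show ?thesis using g[of i] by simp
  qed
  have "p (Poly_Mapping.single (Monomial (l # ls)) 1) =
      p (Poly_Mapping.single (Monomial [l]) 1 * Poly_Mapping.single (Monomial ls) 1)"
    by (simp add: mult_single plus_monomial_def)
  also have "\<dots> \<le> p (Poly_Mapping.single (Monomial [l]) 1) * p (Poly_Mapping.single (Monomial ls) 1)"
    by (rule submult)
  also have "\<dots> \<le> B * B ^ length ls"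
    using l Cons B by (intro mult_mono) auto
  finally show ?case by simp
qed

text \<open>The right-hand side depends on \<open>a\<close> and \<open>B\<close> but not on
  \<open>p\<close>, so a common bound on the generators makes the universal seminorm finite.\<close>

lemma (in cstar) free_alg_bound:
  assumes B: "1 \<le> B" and g: "\<And>i. p (gen i) \<le> B"
  shows "p a \<le> (\<Sum>w\<in>Poly_Mapping.keys a. cmod (Poly_Mapping.lookup a w) * B ^ length (letters w))"
proof -
  have "p a = p (\<Sum>w\<in>Poly_Mapping.keys a. Poly_Mapping.single w (Poly_Mapping.lookup a w))"
    by (simp only: free_alg_expansion)
  also have "\<dots> \<le> (\<Sum>w\<in>Poly_Mapping.keys a. p (Poly_Mapping.single w (Poly_Mapping.lookup a w)))"
    by (rule p_sum_le)
  also have "\<dots> \<le> (\<Sum>w\<in>Poly_Mapping.keys a. cmod (Poly_Mapping.lookup a w) * B ^ length (letters w))"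
  proof (rule sum_mono)
    fix w
    have "p (Poly_Mapping.single w (Poly_Mapping.lookup a w)) =
        cmod (Poly_Mapping.lookup a w) * p (Poly_Mapping.single w 1)"
      using scale[of "Poly_Mapping.lookup a w" "Poly_Mapping.single w 1"] by simp
    also have "\<dots> \<le> cmod (Poly_Mapping.lookup a w) * B ^ length (letters w)"
      using word_bound[OF assms, of "letters w"] by (intro mult_left_mono) auto
    finally show "p (Poly_Mapping.single w (Poly_Mapping.lookup a w)) \<le>
        cmod (Poly_Mapping.lookup a w) * B ^ length (letters w)" .
  qed
  finally show ?thesis .
qed

text \<open>Generators are self-adjoint only modulo the kernel of \<open>p\<close>, so they are
  replaced by their real parts \<open>h j\<close>. Then \<open>h i * h i\<close> and the sum of the
  other squares are quasi-positive and add up to 1 modulo the kernel, which bounds the fourth power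
  of \<open>p (h i)\<close>.\<close>

lemma sphere_gen_bound:
  fixes p :: "'n::finite free_alg \<Rightarrow> real"
  assumes "cstar_seminorm p" and R: "\<And>r. r \<in> sphere_relations \<epsilon> \<Longrightarrow> p r = 0"
  shows "p (gen i) \<le> exp 9"
proof -
  interpret cstar p by unfold_locales fact
  define h where "h j = fscale (1 / 2) (gen j + fstar (gen j))" for j :: 'n
  have hs: "fstar (h j) = h j" for j
    by (simp add: h_def fstar_add add.commute)
  have gh: "p (h j - gen j) = 0" for j
  proof -
    have "fscale (1 / 2) (gen j) + fscale (1 / 2) (gen j) = gen j"
      by (simp add: fscale_add_left[symmetric])
    then have "h j - gen j = fscale (- 1 / 2) (gen j - fstar (gen j))"
      by (simp add: h_def fscale_add_right fscale_diff_right algebra_simps)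
    moreover have "p (gen j - fstar (gen j)) = 0"
      by (rule R) (auto simp: sphere_relations_def)
    ultimately show ?thesis by (simp only: scale)
  qed
  have sq: "p (h j * h j - gen j ^ 2) = 0" for j
  proof -
    have e: "h j * h j - gen j ^ 2 = h j * (h j - gen j) + (h j - gen j) * gen j"
      by (simp add: power2_eq_square algebra_simps)
    have "p (h j * h j - gen j ^ 2) \<le> p (h j) * p (h j - gen j) + p (h j - gen j) * p (gen j)"
      unfolding e using triangle[of "h j * (h j - gen j)" "(h j - gen j) * gen j"]
        submult[of "h j" "h j - gen j"] submult[of "h j - gen j" "gen j"] by linarith
    then show ?thesis using nonneg[of "h j * h j - gen j ^ 2"] by (simp add: gh del: nonneg)
  qed
  have "p ((\<Sum>j\<in>UNIV. h j * h j) - 1) = p ((\<Sum>j\<in>UNIV. gen j ^ 2) - 1)"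
  proof (rule cong_p)
    have "p (\<Sum>j\<in>UNIV. h j * h j - gen j ^ 2) \<le> (\<Sum>j\<in>UNIV. p (h j * h j - gen j ^ 2))"
      by (rule p_sum_le)
    then show "p ((\<Sum>j\<in>UNIV. h j * h j) - 1 - ((\<Sum>j\<in>UNIV. gen j ^ 2) - 1)) = 0"
      using nonneg[of "\<Sum>j\<in>UNIV. h j * h j - gen j ^ 2"]
      by (simp add: sq sum_subtractf del: nonneg)
  qed
  also have "\<dots> = 0"
    by (rule R) (auto simp: sphere_relations_def)
  finally have "p (h i * h i + (\<Sum>j\<in>UNIV - {i}. h j * h j) - 1) = 0"
    by (simp add: sum.remove[of UNIV i])
  then have "(p (h i * h i))\<^sup>2 \<le> exp 9"
    by (intro quasi_pos_bound[of _ "\<Sum>j\<in>UNIV - {i}. h j * h j"] quasi_pos_sum quasi_pos_square hs)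
      (simp_all add: fstar_mult hs)
  then have 4: "p (h i) ^ 4 \<le> exp 9"
    by (simp add: selfadjoint_square hs)
  have "p (gen i) = p (h i)" using cong_p[OF gh] by simp
  also have "\<dots> \<le> exp 9"
  proof (cases "p (h i) \<le> 1")
    case True
    moreover have "(1 :: real) \<le> exp 9" by simp
    ultimately show ?thesis by linarith
  next
    case False
    then have "p (h i) ^ 1 \<le> p (h i) ^ 4" by (intro power_increasing) auto
    then show ?thesis using 4 by simp
  qed
  finally show ?thesis .
qed

lemma bdd_above_sphere_seminorms:
  "bdd_above ((\<lambda>p. p a) ` {p. cstar_seminorm p \<and> (\<forall>r\<in>sphere_relations \<epsilon>. p r = 0)})"
proof (rule bdd_aboveI2)
  fix p :: "'a free_alg \<Rightarrow> real"
  assume p: "p \<in> {p. cstar_seminorm p \<and> (\<forall>r\<in>sphere_relations \<epsilon>. p r = 0)}"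
  then interpret cstar p by unfold_locales simp
  show "p a \<le> (\<Sum>w\<in>Poly_Mapping.keys a. cmod (Poly_Mapping.lookup a w) * exp 9 ^ length (letters w))"
    using p by (intro free_alg_bound sphere_gen_bound[of p \<epsilon>]) auto
qed

section \<open>The sphere seminorm and its universal property\<close>

definition sphere_seminorm :: "nat ^ 'n ^ 'n \<Rightarrow> 'n::finite free_alg \<Rightarrow> real" where
  "sphere_seminorm \<epsilon> = universal_seminorm (sphere_relations \<epsilon>)"

lemma le_sphere_seminorm:
  assumes "cstar_seminorm p" and "\<And>r. r \<in> sphere_relations \<epsilon> \<Longrightarrow> p r = 0"
  shows "p a \<le> sphere_seminorm \<epsilon> a"
  unfolding sphere_seminorm_def universal_seminorm_def
  using assms by (intro cSUP_upper bdd_above_sphere_seminorms) auto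

text \<open>The zero seminorm vanishes on all relations, so the supremum is taken over a nonempty
  set.\<close>

lemma cstar_seminorm_zero: "cstar_seminorm (\<lambda>_. 0)"
  by (simp add: cstar_seminorm_def)

lemma sphere_seminorms_nonempty: "{p. cstar_seminorm p \<and> (\<forall>r\<in>R. p r = 0)} \<noteq> {}"
  using cstar_seminorm_zero by fastforce

lemma sphere_seminorm_least:
  assumes "\<And>p. cstar_seminorm p \<Longrightarrow> (\<And>r. r \<in> sphere_relations \<epsilon> \<Longrightarrow> p r = 0) \<Longrightarrow> p a \<le> B"
  shows "sphere_seminorm \<epsilon> a \<le> B"
  unfolding sphere_seminorm_def universal_seminorm_def
  using assms by (intro cSUP_least sphere_seminorms_nonempty) auto

lemma cstar_seminorm_sphere: "cstar_seminorm (sphere_seminorm \<epsilon>)"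
  unfolding sphere_seminorm_def universal_seminorm_def
  by (intro cstar_seminorm_SUP bdd_above_sphere_seminorms sphere_seminorms_nonempty) auto

interpretation sphere: cstar "sphere_seminorm \<epsilon>"
  by unfold_locales (rule cstar_seminorm_sphere)

lemma sphere_seminorm_relation:
  assumes "r \<in> sphere_relations \<epsilon>"
  shows "sphere_seminorm \<epsilon> r = 0"
  using assms by (intro antisym sphere_seminorm_least) auto

text \<open>More relations admit fewer seminorms. This domination is what produces the quotient
  maps.\<close>

lemma sphere_seminorm_mono:
  assumes "sphere_relations \<epsilon> \<subseteq> sphere_relations \<epsilon>'"
  shows "sphere_seminorm \<epsilon>' a \<le> sphere_seminorm \<epsilon> a"
  using assms by (intro sphere_seminorm_least le_sphere_seminorm) auto

section \<open>Lifting Cauchy sequences along a quotient map\<close>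

lemma one_minus_geometric_sum: "(1 - w) * (\<Sum>k<n. w ^ k) = 1 - (w :: 'a::ring_1) ^ n"
proof (induction n)
  case (Suc n)
  have "(1 - w) * (\<Sum>k<Suc n. w ^ k) = (1 - w ^ n) + (1 - w) * w ^ n"
    by (simp only: sum.lessThan_Suc distrib_left Suc)
  then show ?case by (simp add: left_diff_distrib)
qed simp

context cstar
begin

text \<open>A Neumann series: \<open>w = 1 - c (1 + h\<^sup>2)\<close> has \<open>p w < 1\<close> for small \<open>c > 0\<close>.\<close>

lemma approximate_inverse:
  assumes h: "fstar h = h" and "0 < \<eta>"
  shows "\<exists>g. fstar g = g \<and> g * h = h * g \<and> p (1 - (1 + h * h) * g) < \<eta>"
proof -
  define Q where "Q = p h ^ 4"
  have Q: "0 \<le> Q" by (simp add: Q_def)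
  \<comment> \<open>Any \<open>t > 0\<close> with \<open>Q * t < 1\<close> serves, since then
    \<open>1 + Q t^2 < 1 + t\<close>; the next constant \<open>c = t / (1 + t)\<close> is chosen so
    that \<open>(1 + t) w = 1 - t h^2\<close>.\<close>
  define t where "t = 1 / (2 * (1 + Q))"
  have t: "0 < t" "Q * t < 1" using Q by (simp_all add: t_def field_simps)
  define c where "c = t / (1 + t)"
  define w where "w = 1 - fscale (of_real c) (1 + h * h)"
  have ct: "(1 + t) * c = t" using t by (simp add: c_def)
  have "fscale (of_real (1 + t)) w = 1 - fscale (of_real t) (h * h)"
  proof -
    have "fscale (of_real (1 + t)) (fscale (of_real c) x) = fscale (of_real t) x" for x :: "'g free_alg"
      unfolding fscale_fscale of_real_mult[symmetric] ct ..
    moreover have "fscale (of_real (1 + t)) 1 = 1 + fscale (of_real t) (1 :: 'g free_alg)"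
      by (simp add: fscale_add_left)
    ultimately show ?thesis
      by (simp add: w_def fscale_add_right fscale_diff_right del: fscale_fscale of_real_add)
  qed
  then have "(1 + t) * p w = p (1 - fscale (of_real t) (h * h))"
    using t scale[of "of_real (1 + t)" w] by (simp del: of_real_add scale)
  also have "\<dots> \<le> 1 + Q * t\<^sup>2"
    unfolding Q_def using t by (intro one_minus_square_le h) simp
  also have "\<dots> < 1 + t"
    using mult_strict_right_mono[OF t(2) t(1)] by (simp add: power2_eq_square)
  finally have "p w < 1"
    using t by simp
  then obtain n where n: "p w ^ n < \<eta>"
    using real_arch_pow_inv assms by blast
  \<comment> \<open>A partial Neumann sum: \<open>1 - w = c (1 + h^2)\<close>, so \<open>c S\<close>
    inverts \<open>1 + h^2\<close> up to \<open>w ^ n\<close>.\<close>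
  define S where "S = (\<Sum>k<n. w ^ k)"
  have ws: "fstar w = w" by (simp add: w_def fstar_diff fstar_add fstar_mult h)
  have wh: "w * h = h * w" by (simp add: w_def algebra_simps)
  have "fstar S = S" by (simp add: S_def fstar_sum fstar_power ws)
  moreover have "S * h = h * S"
    by (simp add: S_def sum_distrib_left sum_distrib_right power_commuting_commutes[OF wh])
  moreover have "1 - (1 + h * h) * fscale (of_real c) S = w ^ n"
  proof -
    have "(1 + h * h) * fscale (of_real c) S = (1 - w) * S"
      by (simp add: w_def)
    then show ?thesis by (simp add: S_def one_minus_geometric_sum)
  qed
  ultimately show ?thesis
    using n p_power_le[of w n] by (intro exI[of _ "fscale (of_real c) S"]) simp
qed

text \<open>The element \<open>c = a (1 + (a\<^sup>* a)\<^sup>2)\<^sup>-\<^sup>1\<close> is bounded for \<open>p\<close>, and \<open>q (a - c)\<close> is of order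
  \<open>(q a)\<^sup>5\<close>. The resolvent \<open>g\<close> is controlled through \<open>V = (1 + i h) g = (1 - i h)\<^sup>-\<^sup>1\<close>,
  as \<open>V\<^sup>* V = g\<close> and \<open>2 g = V + V\<^sup>*\<close>.\<close>

lemma truncate:
  assumes "cstar_seminorm q" and qp: "\<And>a. q a \<le> p a" and qa: "q a \<le> 1 / 2"
  shows "\<exists>c. p c \<le> 2 \<and> q (a - c) \<le> 1 / 8"
proof -
  interpret q: cstar q by unfold_locales fact
  define h where "h = fstar a * a"
  have h: "fstar h = h" by (simp add: h_def fstar_mult)
  obtain g where g: "fstar g = g" "g * h = h * g" and E: "p (1 - (1 + h * h) * g) < 1 / 16"
    using approximate_inverse[OF h, of "1 / 16"] by auto
  define e where "e = 1 - (1 + h * h) * g"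
  define V where "V = g + fscale \<i> (h * g)"
  have Vs: "fstar V = g - fscale \<i> (h * g)"
    by (simp add: V_def fstar_add fstar_mult g h)
  have "p (fscale 2 g) = p (V + fstar V)"
    unfolding Vs unfolding V_def using fscale_add_left[of 1 1 g] by simp
  then have gV: "p g \<le> p V" using triangle[of V "fstar V"] by simp
  have "V - fstar V = fscale (2 * \<i>) (h * g)"
    unfolding Vs unfolding V_def by (simp only: mult_2 fscale_add_left) simp
  then have "2 * p (h * g) = p (V - fstar V)" by (simp add: norm_mult)
  then have hgV: "p (h * g) \<le> p V" using triangle_diff[of V "fstar V"] by simp
  have ghx: "g * (h * x) = h * (g * x)" for x
    by (simp add: mult.assoc[symmetric] g(2))
  \<comment> \<open>The product is \<open>g (1 + h^2) g\<close>, and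
    \<open>(1 + h^2) g = 1 - e\<close>; since \<open>g\<close> is only an approximate inverse, the
    error \<open>g * e\<close> remains and turns the bound 1 on \<open>p V\<close> into
    17/16.\<close>
  have "fstar V * V = g * g + (h * g) * (h * g)"
    unfolding Vs unfolding V_def
    by (simp add: distrib_left left_diff_distrib fscale_diff_right mult.assoc ghx)
  also have "\<dots> = g - g * e"
    by (simp add: e_def distrib_right right_diff_distrib distrib_left mult.assoc ghx)
  finally have "(p V)\<^sup>2 = p (g - g * e)" using cstar_identity[of V] by simp
  also have "\<dots> \<le> p g + p g * p e"
    using triangle_diff[of g "g * e"] submult[of g e] by linarith
  also have "\<dots> \<le> p V + p V * (1 / 16)"
    using gV E by (intro add_mono mult_mono) (auto simp: e_def)
  finally have "p V * p V \<le> (17 / 16) * p V" by (simp add: power2_eq_square)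
  then have V: "p V \<le> 17 / 16"
    using mult_right_le_imp_le[of "p V" "p V" "17 / 16"] nonneg[of V] by (cases "p V = 0") auto
  have "(p (a * g))\<^sup>2 = p (g * (h * g))"
    using cstar_identity[of "a * g"] by (simp add: fstar_mult g h_def mult.assoc)
  also have "\<dots> \<le> p g * p (h * g)" by (rule submult)
  also have "\<dots> \<le> (17 / 16) * (17 / 16)"
    using gV hgV V by (intro mult_mono) auto
  also have "\<dots> \<le> 2\<^sup>2" by (simp add: power2_eq_square)
  finally have "p (a * g) \<le> 2" by (rule power2_le_imp_le) simp
  moreover have "q (a - a * g) \<le> 1 / 8"
  proof -
    have qh: "q h \<le> 1 / 4"
      using power_mono[OF qa, of 2] q.cstar_identity[of a] by (simp add: h_def power2_eq_square)
    \<comment> \<open>By definition of \<open>e\<close>, \<open>1 - g = e + h^2 g\<close>. Here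
      \<open>q h = (q a)^2 \<le> 1 / 4\<close> makes the second term small.\<close>
    have "a - a * g = a * (e + h * (h * g))"
      by (simp add: e_def algebra_simps)
    then have "q (a - a * g) \<le> q a * q (e + h * (h * g))"
      by (simp only: q.submult)
    also have "q (e + h * (h * g)) \<le> 1 / 16 + 1 / 4 * (1 / 4 * (17 / 16))"
    proof -
      have "q e \<le> 1 / 16" using qp[of e] E by (simp add: e_def)
      moreover have "q (h * g) \<le> 1 / 4 * (17 / 16)"
        using q.submult[of h g] mult_mono[OF qh, of "q g" "17 / 16"] qp[of g] gV V by simp
      then have "q (h * (h * g)) \<le> 1 / 4 * (1 / 4 * (17 / 16))"
        using q.submult[of h "h * g"] mult_mono[OF qh, of "q (h * g)" "1 / 4 * (17 / 16)"] by simp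
      ultimately show ?thesis using q.triangle[of e "h * (h * g)"] by linarith
    qed
    then have "q a * q (e + h * (h * g)) \<le> 1 / 2 * (1 / 16 + 1 / 4 * (1 / 4 * (17 / 16)))"
      using qa by (intro mult_mono) auto
    finally show ?thesis by simp
  qed
  ultimately show ?thesis by blast
qed

text \<open>Homogeneity, applied to \<open>a / d\<close>. The drop from \<open>d / 2\<close> to
  \<open>d / 8\<close> leaves room in the iteration for halving \<open>d\<close> and for moving on
  to a later term of the sequence.\<close>

lemma truncate_scaled:
  assumes "cstar_seminorm q" and qp: "\<And>a. q a \<le> p a" and d: "0 < d" and qa: "q a \<le> d / 2"
  shows "\<exists>c. p c \<le> 2 * d \<and> q (a - c) \<le> d / 8"
proof -
  interpret q: cstar q by unfold_locales fact
  have "q (fscale (of_real (1 / d)) a) \<le> 1 / 2"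
    using qa d by (simp add: norm_divide field_simps)
  then obtain c where c: "p c \<le> 2" "q (fscale (of_real (1 / d)) a - c) \<le> 1 / 8"
    using truncate assms by blast
  have "a - fscale (of_real d) c = fscale (of_real d) (fscale (of_real (1 / d)) a - c)"
    using d by (simp add: fscale_diff_right)
  then have "q (a - fscale (of_real d) c) = d * q (fscale (of_real (1 / d)) a - c)"
    using d by simp
  also have "\<dots> \<le> d * (1 / 8)"
    using c d by (intro mult_left_mono) auto
  finally have "q (a - fscale (of_real d) c) \<le> d / 8" by simp
  moreover have "p (fscale (of_real d) c) \<le> 2 * d"
    using c d by simp
  ultimately show ?thesis by blast
qed

section \<open>Successive approximation\<close>

lemma Cauchy_geometric:
  assumes X: "\<And>k. p (X (Suc k) - X k) \<le> 2 * (1 / 2) ^ k"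
  shows "seminorm_Cauchy p X"
proof -
  \<comment> \<open>The exact partial sum of the geometric series is kept so that the induction on
    \<open>m\<close> closes.\<close>
  have le: "p (X (k + m) - X k) \<le> 4 * (1 / 2) ^ k * (1 - (1 / 2) ^ m)" for k m
  proof (induction m)
    case (Suc m)
    have "p (X (k + Suc m) - X k) \<le> p (X (Suc (k + m)) - X (k + m)) + p (X (k + m) - X k)"
      using triangle_mid[of "X (k + Suc m)" "X k" "X (k + m)"] by simp
    also have "\<dots> \<le> 2 * (1 / 2) ^ (k + m) + 4 * (1 / 2) ^ k * (1 - (1 / 2) ^ m)"
      using X Suc by (intro add_mono)
    also have "\<dots> = 4 * (1 / 2) ^ k * (1 - (1 / 2) ^ Suc m)"
      by (simp add: power_add algebra_simps)
    finally show ?case .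
  qed simp
  have le': "p (X l - X k) \<le> 4 * (1 / 2) ^ k" if "k \<le> l" for k l
  proof -
    have "p (X l - X k) \<le> 4 * (1 / 2) ^ k * (1 - (1 / 2) ^ (l - k))"
      using le[of k "l - k"] that by simp
    also have "\<dots> \<le> 4 * (1 / 2) ^ k * 1"
      by (intro mult_left_mono) auto
    finally show ?thesis by simp
  qed
  show ?thesis
    unfolding seminorm_Cauchy_def
  proof (intro allI impI)
    fix e :: real assume "0 < e"
    then obtain N where N: "(1 / 2) ^ N < e / 8"
      using real_arch_pow_inv[of "e / 8" "1 / 2"] by auto
    have "p (X k - X l) < e" if "k \<ge> N" "l \<ge> N" for k l
    proof -
      have "p (X k - X l) \<le> p (X k - X N) + p (X N - X l)" by (rule triangle_mid)
      also have "\<dots> \<le> 4 * (1 / 2) ^ N + 4 * (1 / 2) ^ N"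
        using le'[OF that(1)] le'[OF that(2)] p_minus_commute[of "X N" "X l"] by linarith
      finally show ?thesis using N by linarith
    qed
    then show "\<exists>N. \<forall>k\<ge>N. \<forall>l\<ge>N. p (X k - X l) < e" by blast
  qed
qed

text \<open>The lift is built by adding corrections whose \<open>p\<close>-size decays
  geometrically. Each correction comes from \<open>truncate_scaled\<close>, applied to the
  difference between a late term of \<open>Y\<close> and the current approximation.\<close>

lemma lift_Cauchy:
  assumes cs: "cstar_seminorm q" and qp: "\<And>a. q a \<le> p a" and Y: "seminorm_Cauchy q Y"
  shows "\<exists>X. seminorm_Cauchy p X \<and> (\<lambda>k. q (X k - Y k)) \<longlonglongrightarrow> 0"
proof -
  interpret q: cstar q by unfold_locales fact
  define d where "d k = (1 / 2 :: real) ^ k" for k :: nat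
  have d: "0 < d k" "d (Suc k) = d k / 2" for k by (simp_all add: d_def)
  \<comment> \<open>A state consists of an index from which on \<open>Y\<close> stays within
    \<open>d k / 4\<close> of its value there, and an element within \<open>d k / 4\<close> of that
    value, both measured by \<open>q\<close>.\<close>
  define P where "P k s \<longleftrightarrow> q (Y (fst s) - snd s) \<le> d k / 4 \<and>
      (\<forall>l\<ge>fst s. q (Y l - Y (fst s)) \<le> d k / 4)" for k and s :: "nat \<times> 'g free_alg"
  have N: "\<exists>N\<ge>M. \<forall>l\<ge>N. q (Y l - Y N) \<le> d k / 4" for M k
  proof -
    obtain N where "\<forall>k'\<ge>N. \<forall>l\<ge>N. q (Y k' - Y l) < d k / 4"
      using Y d(1)[of k] unfolding seminorm_Cauchy_def by (meson divide_pos_pos zero_less_numeral)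
    then show ?thesis by (intro exI[of _ "max M N"]) (auto intro!: less_imp_le)
  qed
  have "\<exists>f. \<forall>n. P n (f n) \<and> p (snd (f (Suc n)) - snd (f n)) \<le> 2 * d n"
  proof (rule dependent_nat_choice)
    obtain N where "\<forall>l\<ge>N. q (Y l - Y N) \<le> d 0 / 4" using N[of 0 0] by blast
    then have "P 0 (N, Y N)" using d(1)[of 0] by (simp add: P_def)
    then show "\<exists>s. P 0 s" ..
  next
    fix s n assume s: "P n s"
    obtain M where M: "M \<ge> fst s" "\<forall>l\<ge>M. q (Y l - Y M) \<le> d (Suc n) / 4" using N by blast
    \<comment> \<open>One quarter is the old approximation error, the other the move from index
      \<open>fst s\<close> to \<open>M\<close>. The resulting error \<open>d n / 8\<close> after
      correction is \<open>d (Suc n) / 4\<close>.\<close>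
    have "q (Y M - snd s) \<le> d n / 2"
      using q.triangle_mid[of "Y M" "snd s" "Y (fst s)"] s M(1) unfolding P_def by fastforce
    then obtain c where c: "p c \<le> 2 * d n" "q (Y M - snd s - c) \<le> d n / 8"
      using truncate_scaled[OF cs qp d(1)] by blast
    then have "P (Suc n) (M, snd s + c)"
      using M(2) by (simp add: P_def d(2) diff_diff_add)
    then show "\<exists>t. P (Suc n) t \<and> p (snd t - snd s) \<le> 2 * d n"
      using c(1) by (intro exI[of _ "(M, snd s + c)"]) simp
  qed
  then obtain f where f: "\<And>n. P n (f n)" "\<And>n. p (snd (f (Suc n)) - snd (f n)) \<le> 2 * d n"
    by blast
  define X where "X n = snd (f n)" for n
  have "seminorm_Cauchy p X"
    using f(2) by (intro Cauchy_geometric) (simp add: X_def d_def)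
  moreover have "(\<lambda>k. q (X k - Y k)) \<longlonglongrightarrow> 0"
  proof (rule LIMSEQ_I)
    fix e :: real assume e: "0 < e"
    then obtain M where M: "\<forall>k\<ge>M. \<forall>l\<ge>M. q (Y k - Y l) < e / 2"
      using Y unfolding seminorm_Cauchy_def by (meson half_gt_zero)
    obtain K where K: "d K < e / 2"
      using real_arch_pow_inv[of "e / 2" "1 / 2"] e by (auto simp: d_def)
    have "q (X k - Y k) < e" if k: "k \<ge> max M K" for k
    proof -
      define n where "n = fst (f k)"
      \<comment> \<open>The index \<open>n\<close> of stage \<open>k\<close> may lie on either side
        of \<open>k\<close>. The invariant compares \<open>Y n\<close> with later terms, the Cauchy
        property compares \<open>Y k\<close> with terms beyond \<open>M\<close>;
        \<open>max n k\<close> lies in both ranges.\<close>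
      define l where "l = max n k"
      have dk: "d k \<le> d K" using k by (simp add: d_def power_decreasing)
      have 1: "q (Y n - X k) \<le> d k / 4" "q (Y l - Y n) \<le> d k / 4"
        using f(1)[of k] by (auto simp: P_def n_def X_def l_def)
      have 2: "q (Y l - Y k) < e / 2" using M k by (auto simp: l_def)
      have "q (X k - Y k) \<le> q (X k - Y n) + (q (Y n - Y l) + q (Y l - Y k))"
        using q.triangle_mid[of "X k" "Y k" "Y n"] q.triangle_mid[of "Y n" "Y k" "Y l"] by linarith
      then show ?thesis
        using 1 2 dk K d(1)[of k] q.p_minus_commute[of "X k" "Y n"] q.p_minus_commute[of "Y n" "Y l"]
        by linarith
    qed
    then show "\<exists>no. \<forall>n\<ge>no. norm (q (X n - Y n) - 0) < e" by (intro exI[of _ "max M K"]) auto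
  qed
  ultimately show ?thesis by blast
qed

end

section \<open>The Hausdorff completion\<close>

context cstar
begin

lemma Cauchy_const [simp]: "seminorm_Cauchy p (\<lambda>k. a)"
  by (simp add: seminorm_Cauchy_def)

lemma Cauchy_bounded:
  assumes "seminorm_Cauchy p X"
  shows "\<exists>B>0. \<forall>k. p (X k) \<le> B"
proof -
  obtain N where N: "\<forall>k\<ge>N. \<forall>l\<ge>N. p (X k - X l) < 1"
    using assms unfolding seminorm_Cauchy_def by (meson zero_less_one)
  define B where "B = 1 + (\<Sum>k\<le>N. p (X k))"
  have le: "p (X k) \<le> (\<Sum>k\<le>N. p (X k))" if "k \<le> N" for k
    using that by (intro member_le_sum) auto
  have "p (X k) \<le> B" for k
  proof (cases "k \<le> N")
    case False
    then have "p (X k - X N) < 1" using N by simp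
    then show ?thesis using abs_diff_le[of "X k" "X N"] le[of N] by (simp add: B_def)
  qed (use le in \<open>simp add: B_def add_increasing\<close>)
  moreover have "0 < B" unfolding B_def by (intro add_pos_nonneg sum_nonneg) auto
  ultimately show ?thesis by blast
qed

lemma Cauchy_lipschitz:
  assumes X: "seminorm_Cauchy p X" and le: "\<And>k l. p (Y k - Y l) \<le> C * p (X k - X l)"
  shows "seminorm_Cauchy p Y"
  unfolding seminorm_Cauchy_def
proof (intro allI impI)
  fix e :: real assume e: "0 < e"
  \<comment> \<open>\<open>C\<close> may be 0, as for multiplication by the scalar 0, so a positive
    constant replaces it before dividing.\<close>
  define D where "D = max C 1"
  have D: "0 < D" "C \<le> D" by (auto simp: D_def)
  obtain N where N: "\<forall>k\<ge>N. \<forall>l\<ge>N. p (X k - X l) < e / D"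
    using X e D unfolding seminorm_Cauchy_def by (meson divide_pos_pos)
  have "p (Y k - Y l) < e" if "k \<ge> N" "l \<ge> N" for k l
  proof -
    have "p (Y k - Y l) \<le> D * p (X k - X l)"
      using le[of k l] mult_right_mono[OF D(2) nonneg[of "X k - X l"]] by linarith
    also have "\<dots> < D * (e / D)"
      using N that D by (intro mult_strict_left_mono) auto
    finally show ?thesis using D by simp
  qed
  then show "\<exists>N. \<forall>k\<ge>N. \<forall>l\<ge>N. p (Y k - Y l) < e" by blast
qed

lemma Cauchy_combine:
  assumes X: "seminorm_Cauchy p X" and Y: "seminorm_Cauchy p Y" and C: "0 < C"
    and le: "\<And>k l. p (Z k - Z l) \<le> C * p (X k - X l) + C * p (Y k - Y l)"
  shows "seminorm_Cauchy p Z"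
  unfolding seminorm_Cauchy_def
proof (intro allI impI)
  fix e :: real assume e: "0 < e"
  then have e': "0 < e / (2 * C)" using C by simp
  obtain N where N: "\<forall>k\<ge>N. \<forall>l\<ge>N. p (X k - X l) < e / (2 * C)"
    using X e' unfolding seminorm_Cauchy_def by meson
  obtain M where M: "\<forall>k\<ge>M. \<forall>l\<ge>M. p (Y k - Y l) < e / (2 * C)"
    using Y e' unfolding seminorm_Cauchy_def by meson
  have "p (Z k - Z l) < e" if "k \<ge> max N M" "l \<ge> max N M" for k l
  proof -
    have "p (X k - X l) < e / (2 * C)" "p (Y k - Y l) < e / (2 * C)"
      using N M that by auto
    then have "C * p (X k - X l) < e / 2" "C * p (Y k - Y l) < e / 2"
      using C by (simp_all add: field_simps)
    then show ?thesis using le[of k l] by linarith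
  qed
  then show "\<exists>N. \<forall>k\<ge>N. \<forall>l\<ge>N. p (Z k - Z l) < e" by blast
qed

lemma Cauchy_add:
  assumes "seminorm_Cauchy p X" and "seminorm_Cauchy p Y"
  shows "seminorm_Cauchy p (\<lambda>k. X k + Y k)"
proof (rule Cauchy_combine[OF assms, of 1])
  fix k l
  show "p (X k + Y k - (X l + Y l)) \<le> 1 * p (X k - X l) + 1 * p (Y k - Y l)"
    using triangle[of "X k - X l" "Y k - Y l"] by (simp add: algebra_simps)
qed simp

lemma mult_diff_le: "p (a * b - c * d) \<le> p a * p (b - d) + p (a - c) * p d"
proof -
  have "a * b - c * d = a * (b - d) + (a - c) * d" by (simp add: algebra_simps)
  then show ?thesis
    using triangle[of "a * (b - d)" "(a - c) * d"] submult[of a "b - d"] submult[of "a - c" d] by simp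
qed

lemma Cauchy_mult:
  assumes X: "seminorm_Cauchy p X" and Y: "seminorm_Cauchy p Y"
  shows "seminorm_Cauchy p (\<lambda>k. X k * Y k)"
proof -
  obtain B C where B: "B > 0" "\<And>k. p (X k) \<le> B" and C: "C > 0" "\<And>k. p (Y k) \<le> C"
    using Cauchy_bounded X Y by metis
  show ?thesis
  proof (rule Cauchy_combine[OF X Y, of "B + C"])
    fix k l
    have "p (X k) * p (Y k - Y l) \<le> (B + C) * p (Y k - Y l)"
      using B(1) B(2)[of k] C(1) by (intro mult_right_mono) auto
    moreover have "p (X k - X l) * p (Y l) \<le> p (X k - X l) * (B + C)"
      using B(1) C(1) C(2)[of l] by (intro mult_left_mono) auto
    ultimately show "p (X k * Y k - X l * Y l) \<le> (B + C) * p (X k - X l) + (B + C) * p (Y k - Y l)"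
      using mult_diff_le[of "X k" "Y k" "X l" "Y l"] mult.commute[of "B + C" "p (X k - X l)"] by linarith
  qed (use B C in simp)
qed

lemma Cauchy_fscale:
  assumes "seminorm_Cauchy p X"
  shows "seminorm_Cauchy p (\<lambda>k. fscale c (X k))"
  using assms by (rule Cauchy_lipschitz[where C = "cmod c"]) (simp flip: fscale_diff_right)

lemma Cauchy_fstar:
  assumes "seminorm_Cauchy p X"
  shows "seminorm_Cauchy p (\<lambda>k. fstar (X k))"
  using assms by (rule Cauchy_lipschitz[where C = 1]) (simp flip: fstar_diff)

section \<open>Classes of Cauchy sequences and the operations on them\<close>

lemma completion_rel_iff:
  "(X, Y) \<in> completion_rel p \<longleftrightarrow>
     seminorm_Cauchy p X \<and> seminorm_Cauchy p Y \<and> (\<lambda>k. p (X k - Y k)) \<longlonglongrightarrow> 0"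
  by (simp add: completion_rel_def)

lemma tendsto_zero_le:
  assumes "f \<longlonglongrightarrow> 0" and "\<And>k. p (Z k) \<le> f k"
  shows "(\<lambda>k. p (Z k)) \<longlonglongrightarrow> 0"
  using assms by (intro tendsto_sandwich[OF _ _ tendsto_const assms(1)]) auto

lemma equiv_completion_rel: "equiv {X. seminorm_Cauchy p X} (completion_rel p)"
proof (rule equivI)
  show "completion_rel p \<subseteq> {X. seminorm_Cauchy p X} \<times> {X. seminorm_Cauchy p X}"
    by (auto simp: completion_rel_def)
  show "refl_on {X. seminorm_Cauchy p X} (completion_rel p)"
    by (auto simp: refl_on_def completion_rel_def)
  show "sym (completion_rel p)"
    by (auto simp: sym_def completion_rel_def p_minus_commute)
  show "trans (completion_rel p)"
  proof (rule transI)
    fix X Y Z assume XY: "(X, Y) \<in> completion_rel p" and YZ: "(Y, Z) \<in> completion_rel p"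
    have "(\<lambda>k. p (X k - Y k) + p (Y k - Z k)) \<longlonglongrightarrow> 0 + 0"
      using XY YZ by (intro tendsto_add) (auto simp: completion_rel_iff)
    then have "(\<lambda>k. p (X k - Z k)) \<longlonglongrightarrow> 0"
      by (intro tendsto_zero_le[of "\<lambda>k. p (X k - Y k) + p (Y k - Z k)"]) (auto intro: triangle_mid)
    then show "(X, Z) \<in> completion_rel p" using XY YZ by (auto simp: completion_rel_iff)
  qed
qed

lemma class_eq_iff:
  assumes "seminorm_Cauchy p X" and "seminorm_Cauchy p Y"
  shows "completion_class p X = completion_class p Y \<longleftrightarrow> (\<lambda>k. p (X k - Y k)) \<longlonglongrightarrow> 0"
  unfolding completion_class_def
  using eq_equiv_class_iff[OF equiv_completion_rel, of X Y] assms by (simp add: completion_rel_iff)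

text \<open>Turns equations between polynomials in the generators into the vanishing of a
  seminorm.\<close>

lemma class_const_eq_iff: "completion_class p (\<lambda>k. a) = completion_class p (\<lambda>k. b) \<longleftrightarrow> p (a - b) = 0"
  by (simp add: class_eq_iff tendsto_const_iff)

lemma mem_class_iff:
  "Y \<in> completion_class p X \<longleftrightarrow>
     seminorm_Cauchy p X \<and> seminorm_Cauchy p Y \<and> (\<lambda>k. p (X k - Y k)) \<longlonglongrightarrow> 0"
  by (simp add: completion_class_def completion_rel_iff)

lemma class_self: "seminorm_Cauchy p X \<Longrightarrow> X \<in> completion_class p X"
  by (simp add: mem_class_iff)

lemma carrier_completion: "carrier (completion p) = completion_class p ` {X. seminorm_Cauchy p X}"
  by (auto simp: completion_def completion_class_def quotient_def)

text \<open>Operations on the completion are unions over all representatives. If the result is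
  independent of the representative, the union is one of equal sets and collapses to any one of
  them.\<close>

lemma UN_class:
  assumes X: "seminorm_Cauchy p X"
    and "\<And>X'. seminorm_Cauchy p X' \<Longrightarrow> (\<lambda>k. p (X k - X' k)) \<longlonglongrightarrow> 0 \<Longrightarrow> F X' = F X"
  shows "(\<Union>X'\<in>completion_class p X. F X') = F X"
proof (rule SUP_eq_const)
  show "completion_class p X \<noteq> {}"
    using class_self[OF X] by blast
  show "F X' = F X" if "X' \<in> completion_class p X" for X'
    using that by (intro assms(2)) (simp_all add: mem_class_iff)
qed

lemma mult_tendsto_zero:
  assumes X: "seminorm_Cauchy p X" and Y': "seminorm_Cauchy p Y'"
    and XX: "(\<lambda>k. p (X k - X' k)) \<longlonglongrightarrow> 0" and YY: "(\<lambda>k. p (Y k - Y' k)) \<longlonglongrightarrow> 0"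
  shows "(\<lambda>k. p (X k * Y k - X' k * Y' k)) \<longlonglongrightarrow> 0"
proof -
  obtain B C where B: "B > 0" "\<And>k. p (X k) \<le> B" and C: "C > 0" "\<And>k. p (Y' k) \<le> C"
    using Cauchy_bounded X Y' by metis
  have "(\<lambda>k. B * p (Y k - Y' k) + p (X k - X' k) * C) \<longlonglongrightarrow> B * 0 + 0 * C"
    by (intro tendsto_intros XX YY)
  then have "(\<lambda>k. B * p (Y k - Y' k) + p (X k - X' k) * C) \<longlonglongrightarrow> 0" by simp
  then show ?thesis
  proof (rule tendsto_zero_le)
    fix k
    have "p (X k) * p (Y k - Y' k) \<le> B * p (Y k - Y' k)"
      by (intro mult_right_mono B) simp
    moreover have "p (X k - X' k) * p (Y' k) \<le> p (X k - X' k) * C"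
      by (intro mult_left_mono C) simp
    ultimately show "p (X k * Y k - X' k * Y' k) \<le> B * p (Y k - Y' k) + p (X k - X' k) * C"
      using mult_diff_le[of "X k" "Y k" "X' k" "Y' k"] by linarith
  qed
qed

lemma mult_class:
  assumes X: "seminorm_Cauchy p X" and Y: "seminorm_Cauchy p Y"
  shows "completion_class p X \<otimes>\<^bsub>completion p\<^esub> completion_class p Y = completion_class p (\<lambda>k. X k * Y k)"
proof -
  have "(\<Union>Y'\<in>completion_class p Y. completion_class p (\<lambda>k. X' k * Y' k)) = completion_class p (\<lambda>k. X' k * Y k)"
    if X': "seminorm_Cauchy p X'" for X'
  proof (rule UN_class[OF Y])
    fix Y' assume "seminorm_Cauchy p Y'" "(\<lambda>k. p (Y k - Y' k)) \<longlonglongrightarrow> 0"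
    then show "completion_class p (\<lambda>k. X' k * Y' k) = completion_class p (\<lambda>k. X' k * Y k)"
      using X' Y
      by (subst class_eq_iff) (auto intro!: Cauchy_mult mult_tendsto_zero simp: p_minus_commute[of "Y' _"])
  qed
  moreover have "X' \<in> completion_class p X \<Longrightarrow> seminorm_Cauchy p X'" for X'
    by (simp add: mem_class_iff)
  ultimately have "completion_class p X \<otimes>\<^bsub>completion p\<^esub> completion_class p Y =
      (\<Union>X'\<in>completion_class p X. completion_class p (\<lambda>k. X' k * Y k))"
    by (simp add: completion_def)
  also have "\<dots> = completion_class p (\<lambda>k. X k * Y k)"
  proof (rule UN_class[OF X])
    fix X' assume "seminorm_Cauchy p X'" "(\<lambda>k. p (X k - X' k)) \<longlonglongrightarrow> 0"
    then show "completion_class p (\<lambda>k. X' k * Y k) = completion_class p (\<lambda>k. X k * Y k)"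
      using X Y
      by (subst class_eq_iff) (auto intro!: Cauchy_mult mult_tendsto_zero simp: p_minus_commute[of "X' _"])
  qed
  finally show ?thesis .
qed

lemma add_class:
  assumes X: "seminorm_Cauchy p X" and Y: "seminorm_Cauchy p Y"
  shows "completion_class p X \<oplus>\<^bsub>completion p\<^esub> completion_class p Y = completion_class p (\<lambda>k. X k + Y k)"
proof -
  have "(\<Union>Y'\<in>completion_class p Y. completion_class p (\<lambda>k. X' k + Y' k)) = completion_class p (\<lambda>k. X' k + Y k)"
    if X': "seminorm_Cauchy p X'" for X'
  proof (rule UN_class[OF Y])
    fix Y' assume "seminorm_Cauchy p Y'" "(\<lambda>k. p (Y k - Y' k)) \<longlonglongrightarrow> 0"
    then show "completion_class p (\<lambda>k. X' k + Y' k) = completion_class p (\<lambda>k. X' k + Y k)"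
      using X' Y
      by (subst class_eq_iff) (auto intro!: Cauchy_add simp: p_minus_commute[of "Y' _"])
  qed
  moreover have "X' \<in> completion_class p X \<Longrightarrow> seminorm_Cauchy p X'" for X'
    by (simp add: mem_class_iff)
  ultimately have "completion_class p X \<oplus>\<^bsub>completion p\<^esub> completion_class p Y =
      (\<Union>X'\<in>completion_class p X. completion_class p (\<lambda>k. X' k + Y k))"
    by (simp add: completion_def)
  also have "\<dots> = completion_class p (\<lambda>k. X k + Y k)"
  proof (rule UN_class[OF X])
    fix X' assume "seminorm_Cauchy p X'" "(\<lambda>k. p (X k - X' k)) \<longlonglongrightarrow> 0"
    then show "completion_class p (\<lambda>k. X' k + Y k) = completion_class p (\<lambda>k. X k + Y k)"
      using X Y
      by (subst class_eq_iff) (auto intro!: Cauchy_add simp: p_minus_commute[of "X' _"])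
  qed
  finally show ?thesis .
qed

lemma smult_class:
  assumes X: "seminorm_Cauchy p X"
  shows "c \<odot>\<^bsub>completion p\<^esub> completion_class p X = completion_class p (\<lambda>k. fscale c (X k))"
proof -
  have "(\<Union>X'\<in>completion_class p X. completion_class p (\<lambda>k. fscale c (X' k))) =
      completion_class p (\<lambda>k. fscale c (X k))"
  proof (rule UN_class[OF X])
    fix X' assume "seminorm_Cauchy p X'" "(\<lambda>k. p (X k - X' k)) \<longlonglongrightarrow> 0"
    then show "completion_class p (\<lambda>k. fscale c (X' k)) = completion_class p (\<lambda>k. fscale c (X k))"
      using X by (subst class_eq_iff)
        (auto intro!: Cauchy_fscale tendsto_mult_right_zero simp: p_minus_commute[of "X' _"] simp flip: fscale_diff_right)
  qed
  then show ?thesis by (simp add: completion_def)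
qed

lemma star_class:
  assumes X: "seminorm_Cauchy p X"
  shows "normed_star_algebra.star (completion p) (completion_class p X) = completion_class p (\<lambda>k. fstar (X k))"
proof -
  have "(\<Union>X'\<in>completion_class p X. completion_class p (\<lambda>k. fstar (X' k))) =
      completion_class p (\<lambda>k. fstar (X k))"
  proof (rule UN_class[OF X])
    fix X' assume "seminorm_Cauchy p X'" "(\<lambda>k. p (X k - X' k)) \<longlonglongrightarrow> 0"
    then show "completion_class p (\<lambda>k. fstar (X' k)) = completion_class p (\<lambda>k. fstar (X k))"
      using X by (subst class_eq_iff)
        (auto intro!: Cauchy_fstar simp: p_minus_commute[of "X' _"] simp flip: fstar_diff)
  qed
  then show ?thesis by (simp add: completion_def)
qed

lemma Cauchy_mono:
  assumes "seminorm_Cauchy p X" and "\<And>a. q a \<le> p a"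
  shows "seminorm_Cauchy q X"
  using assms unfolding seminorm_Cauchy_def by (meson le_less_trans)

end

section \<open>The quotient map between completions\<close>

text \<open>The extension of the identity of the free algebra, encoded as a union over
  representatives like the operations of \<open>completion\<close>; if \<open>p\<close> dominates
  \<open>q\<close>, all members of the union for a class of \<open>p\<close> coincide.\<close>

definition completion_map ::
    "('g free_alg \<Rightarrow> real) \<Rightarrow> (nat \<Rightarrow> 'g free_alg) set \<Rightarrow> (nat \<Rightarrow> 'g free_alg) set" where
  "completion_map q A = (\<Union>X\<in>A. completion_class q X)"

locale cstar_pair = cstar p + q: cstar q for p q :: "'g free_alg \<Rightarrow> real" +
  assumes q_le_p: "q a \<le> p a"
begin

lemma Cauchy_q: "seminorm_Cauchy p X \<Longrightarrow> seminorm_Cauchy q X"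
  using Cauchy_mono q_le_p by blast

lemma completion_map_class:
  assumes X: "seminorm_Cauchy p X"
  shows "completion_map q (completion_class p X) = completion_class q X"
  unfolding completion_map_def
proof (rule UN_class[OF X])
  fix X' assume X': "seminorm_Cauchy p X'" and XX: "(\<lambda>k. p (X k - X' k)) \<longlonglongrightarrow> 0"
  from XX have "(\<lambda>k. q (X k - X' k)) \<longlonglongrightarrow> 0"
    by (rule q.tendsto_zero_le) (rule q_le_p)
  then show "completion_class q X' = completion_class q X"
    using X X' by (subst q.class_eq_iff) (auto intro: Cauchy_q simp: q.p_minus_commute[of "X' _"])
qed

lemma completion_map_hom: "completion_map q \<in> star_hom (completion p) (completion q)"
  unfolding star_hom_def carrier_completion q.carrier_completion
  by (auto simp: completion_map_class mult_class q.mult_class add_class q.add_class smult_class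
      q.smult_class star_class q.star_class Cauchy_q Cauchy_mult Cauchy_add Cauchy_fscale Cauchy_fstar)

text \<open>By \<open>lift_Cauchy\<close> every class for \<open>q\<close> has a representative that
  is already Cauchy for \<open>p\<close>.\<close>

lemma completion_map_surj:
  "completion_map q ` carrier (completion p) = carrier (completion q)"
proof (intro equalityI subsetI)
  fix B assume "B \<in> carrier (completion q)"
  then obtain Y where Y: "B = completion_class q Y" "seminorm_Cauchy q Y"
    by (auto simp: q.carrier_completion)
  obtain X where X: "seminorm_Cauchy p X" "(\<lambda>k. q (X k - Y k)) \<longlonglongrightarrow> 0"
    using lift_Cauchy[OF q.cstar_seminorm q_le_p Y(2)] by blast
  then have "completion_map q (completion_class p X) = B"
    using Y by (simp add: completion_map_class q.class_eq_iff Cauchy_q)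
  then show "B \<in> completion_map q ` carrier (completion p)"
    using X by (auto simp: carrier_completion)
qed (auto simp: carrier_completion q.carrier_completion completion_map_class Cauchy_q)

text \<open>The class of the constant sequence \<open>a\<close> is a nonzero element of the
  kernel.\<close>

lemma completion_map_not_inj:
  assumes "p a \<noteq> 0" and "q a = 0"
  shows "\<not> inj_on (completion_map q) (carrier (completion p))"
proof
  assume "inj_on (completion_map q) (carrier (completion p))"
  moreover have "completion_map q (completion_class p (\<lambda>k. a)) = completion_map q (completion_class p (\<lambda>k. 0))"
    using assms by (simp add: completion_map_class q.class_const_eq_iff)
  ultimately have "completion_class p (\<lambda>k. a) = completion_class p (\<lambda>k. 0)"
    by (rule inj_onD) (auto simp: carrier_completion)
  then show False using assms by (simp add: class_const_eq_iff)
qed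

end

section \<open>Operators on the complex plane squared\<close>

text \<open>Cauchy-Schwarz applied to \<open>inner (f (g w)) w\<close>, which is the square of
  \<open>norm (g w)\<close>, and division by \<open>norm (g w)\<close>.\<close>

lemma onorm_adjoint_le:
  fixes f g :: "'a::real_inner \<Rightarrow> 'a"
  assumes f: "bounded_linear f" and adj: "\<And>v w. inner (f v) w = inner v (g w)"
  shows "onorm g \<le> onorm f"
proof (rule onorm_bound)
  fix w
  have "norm (g w) * norm (g w) = inner (f (g w)) w"
    by (simp add: adj dot_square_norm power2_eq_square)
  also have "\<dots> \<le> norm (f (g w)) * norm w"
    by (rule norm_cauchy_schwarz)
  also have "\<dots> \<le> (onorm f * norm (g w)) * norm w"
    by (intro mult_right_mono onorm f) simp
  finally have "norm (g w) * norm (g w) \<le> (onorm f * norm w) * norm (g w)"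
    by (simp add: algebra_simps)
  then show "norm (g w) \<le> onorm f * norm w"
    using onorm_pos_le[OF f] by (cases "norm (g w) = 0") (auto simp: mult_le_cancel_right)
qed (rule onorm_pos_le[OF f])

text \<open>The C*-identity for operators; the lower bound comes from writing
  \<open>norm (f v)\<close> squared as \<open>inner v (g (f v))\<close>.\<close>

lemma onorm_adjoint_compose:
  fixes f g :: "'a::real_inner \<Rightarrow> 'a"
  assumes f: "bounded_linear f" and g: "bounded_linear g"
    and adj: "\<And>v w. inner (f v) w = inner v (g w)"
  shows "onorm (g \<circ> f) = (onorm f)\<^sup>2"
proof (rule antisym)
  have "onorm (g \<circ> f) \<le> onorm g * onorm f"
    by (rule onorm_compose[OF g f])
  also have "\<dots> \<le> onorm f * onorm f"
    by (intro mult_right_mono onorm_adjoint_le adj f onorm_pos_le[OF f])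
  finally show "onorm (g \<circ> f) \<le> (onorm f)\<^sup>2"
    by (simp add: power2_eq_square)
  have gf: "bounded_linear (g \<circ> f)"
    using bounded_linear_compose[OF g f] by (simp add: comp_def)
  have "onorm f \<le> sqrt (onorm (g \<circ> f))"
  proof (rule onorm_bound)
    fix v
    have "(norm (f v))\<^sup>2 = inner v ((g \<circ> f) v)"
      by (simp add: adj[symmetric] dot_square_norm)
    also have "\<dots> \<le> norm v * norm ((g \<circ> f) v)"
      by (rule norm_cauchy_schwarz)
    also have "\<dots> \<le> norm v * (onorm (g \<circ> f) * norm v)"
      by (intro mult_left_mono onorm gf) simp
    also have "\<dots> = (sqrt (onorm (g \<circ> f)) * norm v)\<^sup>2"
      using onorm_pos_le[OF gf] by (simp add: power_mult_distrib power2_eq_square[of "norm v"])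
    finally show "norm (f v) \<le> sqrt (onorm (g \<circ> f)) * norm v"
      by (rule power2_le_imp_le) (simp add: onorm_pos_le[OF gf])
  qed (simp add: onorm_pos_le[OF gf])
  then have "(onorm f)\<^sup>2 \<le> (sqrt (onorm (g \<circ> f)))\<^sup>2"
    by (intro power_mono onorm_pos_le f)
  then show "(onorm f)\<^sup>2 \<le> onorm (g \<circ> f)"
    by (simp add: onorm_pos_le[OF gf])
qed

section \<open>*-representations on pairs of complex numbers\<close>

definition vscale :: "complex \<Rightarrow> complex \<times> complex \<Rightarrow> complex \<times> complex" where
  "vscale c v = (c * fst v, c * snd v)"

lemma vscale_simps [simp]:
  "vscale 0 v = 0" "vscale c 0 = 0" "vscale 1 v = v" "vscale c (vscale d v) = vscale (c * d) v"
  by (simp_all add: vscale_def prod_eq_iff mult.assoc)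

lemma vscale_add_left: "vscale (c + d) v = vscale c v + vscale d v"
  and vscale_add_right: "vscale c (v + w) = vscale c v + vscale c w"
  by (simp_all add: vscale_def prod_eq_iff algebra_simps)

lemma norm_vscale [simp]: "norm (vscale c v) = cmod c * norm v"
  by (simp add: vscale_def norm_prod_def norm_mult power_mult_distrib real_sqrt_mult flip: distrib_left)

text \<open>\<open>inner\<close> is the real part of the Hermitian product, so the adjoint of a
  scalar is its conjugate here too.\<close>

lemma inner_vscale: "inner (vscale c v) w = inner v (vscale (cnj c) w)"
  by (simp add: vscale_def inner_prod_def inner_complex_def algebra_simps)

lemma bounded_linear_vscale: "bounded_linear (vscale c)"
proof (rule bounded_linear_intro[of _ "cmod c"])
  show "vscale c (r *\<^sub>R v) = r *\<^sub>R vscale c v" for r v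
    by (simp add: vscale_def prod_eq_iff)
qed (simp_all add: vscale_add_right mult.commute)

text \<open>Such a family yields a *-representation of the free *-algebra, and its operator norm is
  a C*-seminorm. For complex linear maps, self-adjointness for the real inner product agrees with
  that for the Hermitian one.\<close>

locale selfadjoint_operators =
  fixes L :: "'g \<Rightarrow> complex \<times> complex \<Rightarrow> complex \<times> complex"
  assumes bounded_linear_L: "bounded_linear (L i)"
    and L_vscale: "L i (vscale c v) = vscale c (L i v)"
    and L_selfadjoint: "inner (L i v) w = inner v (L i w)"
begin

fun letter_op :: "'g letter \<Rightarrow> complex \<times> complex \<Rightarrow> complex \<times> complex" where
  "letter_op (Gen i) = L i"
| "letter_op (Adj i) = L i"

definition word_op :: "'g monomial \<Rightarrow> complex \<times> complex \<Rightarrow> complex \<times> complex" where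
  "word_op w = foldr letter_op (letters w)"

definition rep :: "'g free_alg \<Rightarrow> complex \<times> complex \<Rightarrow> complex \<times> complex" where
  "rep a v = (\<Sum>w\<in>Poly_Mapping.keys a. vscale (Poly_Mapping.lookup a w) (word_op w v))"

lemma word_op_zero [simp]: "word_op 0 = id"
  by (simp add: word_op_def zero_monomial_def)

lemma word_op_plus: "word_op (v + w) = word_op v \<circ> word_op w"
  by (simp add: word_op_def plus_monomial_def fun_eq_iff)

lemma word_op_vscale: "word_op w (vscale c v) = vscale c (word_op w v)"
proof -
  have "letter_op l (vscale c v) = vscale c (letter_op l v)" for l v
    by (cases l) (simp_all add: L_vscale)
  then have "foldr letter_op ls (vscale c v) = vscale c (foldr letter_op ls v)" for ls
    by (induction ls) simp_all
  then show ?thesis by (simp add: word_op_def)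
qed

lemma bounded_linear_word_op: "bounded_linear (word_op w)"
proof -
  have l: "bounded_linear (letter_op l)" for l
    by (cases l) (simp_all add: bounded_linear_L)
  have "bounded_linear (foldr letter_op ls)" for ls
    by (induction ls) (auto simp: comp_def id_def intro: bounded_linear_compose[OF l] bounded_linear_ident)
  then show ?thesis by (simp add: word_op_def)
qed

lemma word_op_adjoint: "inner (word_op w x) y = inner x (word_op (monomial_star w) y)"
proof -
  have l: "inner (letter_op l x) y = inner x (letter_op (letter_star l) y)" for l x y
    by (cases l) (simp_all add: L_selfadjoint)
  have "inner (foldr letter_op ls x) y = inner x (foldr letter_op (rev (map letter_star ls)) y)" for ls
    by (induction ls arbitrary: y) (simp_all add: l)
  then show ?thesis by (simp add: word_op_def monomial_star_def)
qed

lemma rep_single [simp]: "rep (Poly_Mapping.single w c) v = vscale c (word_op w v)"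
  by (simp add: rep_def)

lemma rep_zero [simp]: "rep 0 v = 0"
  by (simp add: rep_def)

lemma rep_one [simp]: "rep 1 v = v"
  using rep_single[of 0 1 v] by simp

lemma rep_add: "rep (a + b) v = rep a v + rep b v"
  unfolding rep_def by (rule setsum_keys_plus_distrib) (simp_all add: vscale_add_left)

lemma rep_diff: "rep (a - b) v = rep a v - rep b v"
  using rep_add[of "a - b" b v] by simp

lemma rep_sum: "rep (sum f S) v = (\<Sum>x\<in>S. rep (f x) v)"
  by (induction S rule: infinite_finite_induct) (simp_all add: rep_add)

lemma bounded_linear_rep: "bounded_linear (rep a)"
  unfolding rep_def
  by (intro bounded_linear_sum bounded_linear_compose[OF bounded_linear_vscale bounded_linear_word_op])

lemma rep_mult: "rep (a * b) v = rep a (rep b v)"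
proof (induction a rule: free_alg_induct)
  case (single w c)
  show ?case
  proof (induction b rule: free_alg_induct)
    case (add b b')
    then show ?case
      by (simp add: distrib_left rep_add vscale_add_right
          linear_add[OF bounded_linear.linear[OF bounded_linear_word_op]])
  qed (simp_all add: mult_single word_op_plus word_op_vscale
      linear_0[OF bounded_linear.linear[OF bounded_linear_word_op]])
qed (simp_all add: distrib_right rep_add)

lemma rep_fscale: "rep (fscale c a) v = vscale c (rep a v)"
  by (simp add: fscale_def rep_mult)

lemma rep_adjoint: "inner (rep a v) w = inner v (rep (fstar a) w)"
  by (induction a rule: free_alg_induct)
    (simp_all add: rep_add fstar_add inner_vscale word_op_adjoint word_op_vscale inner_add_left inner_add_right)

lemma rep_gen [simp]: "rep (gen i) v = L i v"
  by (simp add: gen_def word_op_def)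

lemma rep_fstar_gen [simp]: "rep (fstar (gen i)) v = L i v"
  by (simp add: gen_def word_op_def monomial_star_def)

lemma onorm_rep_eq_0_iff: "onorm (rep a) = 0 \<longleftrightarrow> (\<forall>v. rep a v = 0)"
  by (rule onorm_eq_0[OF bounded_linear_rep])

lemma cstar_seminorm_rep: "cstar_seminorm (\<lambda>a. onorm (rep a))"
  unfolding cstar_seminorm_def
proof (intro conjI allI)
  show "0 \<le> onorm (rep a)" for a
    by (rule onorm_pos_le[OF bounded_linear_rep])
  have "onorm (rep (fscale c a)) \<le> cmod c * onorm (rep a)" for c a
  proof (rule onorm_bound)
    show "norm (rep (fscale c a) v) \<le> cmod c * onorm (rep a) * norm v" for v
      using onorm[OF bounded_linear_rep, of a v] by (simp add: rep_fscale mult.assoc mult_left_mono)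
  qed (simp add: onorm_pos_le[OF bounded_linear_rep])
  then show "onorm (rep (fscale c a)) = cmod c * onorm (rep a)" for c a
    by (rule scale_eqI) (rule onorm_pos_le[OF bounded_linear_rep])
  show "onorm (rep (a + b)) \<le> onorm (rep a) + onorm (rep b)" for a b
    using onorm_triangle[OF bounded_linear_rep bounded_linear_rep, of a b] by (simp add: rep_add[abs_def])
  show "onorm (rep (a * b)) \<le> onorm (rep a) * onorm (rep b)" for a b
    using onorm_compose[OF bounded_linear_rep bounded_linear_rep, of a b] by (simp add: rep_mult[abs_def] comp_def)
  show "onorm (rep (fstar a)) = onorm (rep a)" for a
    using onorm_adjoint_le[OF bounded_linear_rep rep_adjoint, of a]
      onorm_adjoint_le[OF bounded_linear_rep rep_adjoint, of "fstar a"] by simp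
  show "onorm (rep (fstar a * a)) = (onorm (rep a))\<^sup>2" for a
    using onorm_adjoint_compose[OF bounded_linear_rep bounded_linear_rep rep_adjoint, of a]
    by (simp add: rep_mult[abs_def] comp_def)
qed

end

text \<open>The Pauli matrices \<open>\<sigma>\<^sub>x / \<surd>2\<close> and \<open>\<sigma>\<^sub>z / \<surd>2\<close> at positions \<open>i\<close> and \<open>j\<close>, zero elsewhere.\<close>

definition pauli :: "'g \<Rightarrow> 'g \<Rightarrow> 'g \<Rightarrow> complex \<times> complex \<Rightarrow> complex \<times> complex" where
  "pauli i j k v =
     (if k = i then vscale (1 / of_real (sqrt 2)) (snd v, fst v)
      else if k = j then vscale (1 / of_real (sqrt 2)) (fst v, - snd v)
      else 0)"

lemma inverse_sqrt2_square: "1 / complex_of_real (sqrt 2) * (1 / complex_of_real (sqrt 2)) = 1 / 2"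
  by (simp flip: of_real_mult)

lemma selfadjoint_operators_pauli: "selfadjoint_operators (pauli i j)"
proof (rule selfadjoint_operators.intro)
  have x: "bounded_linear (\<lambda>v :: complex \<times> complex. (snd v, fst v))"
    by (intro bounded_linear_Pair bounded_linear_fst bounded_linear_snd)
  have z: "bounded_linear (\<lambda>v :: complex \<times> complex. (fst v, - snd v))"
    by (intro bounded_linear_Pair bounded_linear_fst bounded_linear_minus bounded_linear_snd)
  show "bounded_linear (pauli i j k)" for k
    unfolding pauli_def[abs_def]
    using bounded_linear_compose[OF bounded_linear_vscale x] bounded_linear_compose[OF bounded_linear_vscale z]
    by (cases "k = i"; cases "k = j") simp_all
qed (auto simp: pauli_def vscale_def inner_prod_def inner_complex_def zero_prod_def algebra_simps)

interpretation pauli: selfadjoint_operators "pauli i j" for i j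
  by (rule selfadjoint_operators_pauli)

text \<open>Pauli matrices square to the identity, so each scaled one contributes one half and the
  squares of all generators add up to 1.\<close>

lemma pauli_square:
  assumes "i \<noteq> j"
  shows "pauli i j k (pauli i j k v) = (if k = i then vscale (1 / 2) v else 0) + (if k = j then vscale (1 / 2) v else 0)"
  using assms inverse_sqrt2_square
  by (auto simp: pauli_def vscale_def prod_eq_iff simp flip: mult.assoc)

text \<open>The seminorm of the Pauli representation kills all relations, so it lies below the
  universal one, and it does not kill the commutator.\<close>

lemma commutator_nonzero:
  assumes \<epsilon>: "eps_matrix \<epsilon>" and ij: "i \<noteq> j" "\<epsilon> $ i $ j \<noteq> 1"
  shows "sphere_seminorm \<epsilon> (gen i * gen j - gen j * gen i) \<noteq> 0"
proof -
  define p where "p a = onorm (pauli.rep i j a)" for a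
  have p0: "p a = 0 \<longleftrightarrow> (\<forall>v. pauli.rep i j a v = 0)" for a
    unfolding p_def by (rule pauli.onorm_rep_eq_0_iff)
  have cs: "cstar_seminorm p"
    unfolding p_def by (rule pauli.cstar_seminorm_rep)
  have "p r = 0" if r: "r \<in> sphere_relations \<epsilon>" for r
  proof -
    consider k where "r = gen k - fstar (gen k)" | "r = (\<Sum>k\<in>UNIV. gen k ^ 2) - 1"
      | k l where "r = gen k * gen l - gen l * gen k" "\<epsilon> $ k $ l = 1"
      using r by (auto simp: sphere_relations_def)
    then show ?thesis
    proof cases
      case 1
      then show ?thesis by (simp add: p0 pauli.rep_diff)
    next
      case 2
      have "vscale (1 / 2) v + vscale (1 / 2) v = v" for v
        by (simp add: vscale_add_left[symmetric])
      with 2 show ?thesis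
        by (simp add: p0 pauli.rep_diff pauli.rep_sum pauli.rep_mult power2_eq_square
            pauli_square[OF ij(1)] sum.distrib)
    next
      case 3
      have "\<epsilon> $ j $ i \<noteq> 1" "\<epsilon> $ k $ k = 0"
        using \<epsilon> ij unfolding eps_matrix_def by metis+
      \<comment> \<open>A commutation relation inside \<open>{i, j}\<close> would need an entry 1 at
        \<open>(i, j)\<close>, \<open>(j, i)\<close> or on the diagonal. Hence one of the two
        generators acts as 0.\<close>
      then have "\<not> (k \<in> {i, j} \<and> l \<in> {i, j})"
        using 3 ij \<epsilon> unfolding eps_matrix_def by auto
      then show ?thesis
        using 3 by (auto simp: p0 pauli.rep_diff pauli.rep_mult pauli_def vscale_def prod_eq_iff)
    qed
  qed
  then have "p (gen i * gen j - gen j * gen i) \<le> sphere_seminorm \<epsilon> (gen i * gen j - gen j * gen i)"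
    using cs by (intro le_sphere_seminorm)
  moreover have "p (gen i * gen j - gen j * gen i) \<noteq> 0"
  proof -
    \<comment> \<open>The two products send \<open>(1, 0)\<close> to \<open>(0, 1/2)\<close> and
      \<open>(0, -1/2)\<close>, so the commutator sends it to \<open>(0, 1)\<close>.\<close>
    have "pauli.rep i j (gen i * gen j - gen j * gen i) (1, 0) \<noteq> 0"
      using ij by (simp add: pauli.rep_diff pauli.rep_mult pauli_def vscale_def prod_eq_iff)
    then show ?thesis unfolding p0 by blast
  qed
  moreover have "0 \<le> p (gen i * gen j - gen j * gen i)"
    using cs by (simp add: cstar_seminorm_def)
  ultimately show ?thesis by linarith
qed

section \<open>Comparison of the spheres\<close>

lemma C_sphere_eq: "C_sphere \<epsilon> = completion (sphere_seminorm \<epsilon>)"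
  by (simp add: C_sphere_def universal_cstar_algebra_def sphere_seminorm_def)

lemma sphere_gen_eq: "sphere_gen \<epsilon> i = completion_class (sphere_seminorm \<epsilon>) (\<lambda>k. gen i)"
  by (simp add: sphere_gen_def universal_gen_def sphere_seminorm_def)

lemma sphere_gen_in_carrier: "sphere_gen \<epsilon> i \<in> carrier (C_sphere \<epsilon>)"
  by (auto simp: C_sphere_eq sphere_gen_eq sphere.carrier_completion)

lemma mult_in_carrier:
  assumes "A \<in> carrier (C_sphere \<epsilon>)" and "B \<in> carrier (C_sphere \<epsilon>)"
  shows "A \<otimes>\<^bsub>C_sphere \<epsilon>\<^esub> B \<in> carrier (C_sphere \<epsilon>)"
  using assms
  by (auto simp: C_sphere_eq sphere.carrier_completion sphere.mult_class intro!: imageI sphere.Cauchy_mult)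

text \<open>The off-diagonal entries of \<open>\<epsilon>\<close> can thus be read off from products
  of generators.\<close>

lemma sphere_gen_commute_iff:
  assumes "eps_matrix \<epsilon>" and "i \<noteq> j"
  shows "sphere_gen \<epsilon> i \<otimes>\<^bsub>C_sphere \<epsilon>\<^esub> sphere_gen \<epsilon> j =
      sphere_gen \<epsilon> j \<otimes>\<^bsub>C_sphere \<epsilon>\<^esub> sphere_gen \<epsilon> i \<longleftrightarrow> \<epsilon> $ i $ j = 1"
proof -
  have "sphere_seminorm \<epsilon> (gen i * gen j - gen j * gen i) = 0" if "\<epsilon> $ i $ j = 1"
    using that by (intro sphere_seminorm_relation) (auto simp: sphere_relations_def)
  then show ?thesis
    using commutator_nonzero[OF assms]
    by (auto simp: C_sphere_eq sphere_gen_eq sphere.mult_class sphere.class_const_eq_iff)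
qed

text \<open>Entries are 0 or 1, so different entries differ in being 1; the common zero diagonal
  forces \<open>i \<noteq> j\<close>.\<close>

lemma eps_matrix_neqE:
  assumes "eps_matrix \<epsilon>" and "eps_matrix \<epsilon>'" and "\<epsilon> \<noteq> \<epsilon>'"
  obtains i j where "i \<noteq> j" and "(\<epsilon> $ i $ j = 1) \<noteq> (\<epsilon>' $ i $ j = 1)"
proof -
  obtain i j where ij: "\<epsilon> $ i $ j \<noteq> \<epsilon>' $ i $ j"
    using assms(3) by (auto simp: vec_eq_iff)
  moreover have "\<epsilon> $ i $ j \<in> {0, 1}" "\<epsilon>' $ i $ j \<in> {0, 1}"
    using assms unfolding eps_matrix_def by blast+
  moreover have "i \<noteq> j"
    using assms ij unfolding eps_matrix_def by metis
  ultimately show ?thesis using that by auto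
qed

text \<open>An injective multiplicative map that fixes the generators preserves and reflects their
  commutation, which determines the matrix.\<close>

lemma no_star_iso:
  assumes \<epsilon>: "eps_matrix \<epsilon>" and \<epsilon>': "eps_matrix \<epsilon>'" and "\<epsilon> \<noteq> \<epsilon>'"
    and \<phi>: "\<phi> \<in> star_iso (C_sphere \<epsilon>) (C_sphere \<epsilon>')" and g: "\<And>i. \<phi> (sphere_gen \<epsilon> i) = sphere_gen \<epsilon>' i"
  shows False
proof -
  obtain i j where ij: "i \<noteq> j" "(\<epsilon> $ i $ j = 1) \<noteq> (\<epsilon>' $ i $ j = 1)"
    using eps_matrix_neqE assms(1-3) by blast
  have inj: "inj_on \<phi> (carrier (C_sphere \<epsilon>))"
    using \<phi> by (auto simp: star_iso_def bij_betw_def)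
  have m: "\<phi> (sphere_gen \<epsilon> k \<otimes>\<^bsub>C_sphere \<epsilon>\<^esub> sphere_gen \<epsilon> l) =
      sphere_gen \<epsilon>' k \<otimes>\<^bsub>C_sphere \<epsilon>'\<^esub> sphere_gen \<epsilon>' l" for k l
    using \<phi> by (simp add: star_iso_def star_hom_def sphere_gen_in_carrier g)
  have "sphere_gen \<epsilon> i \<otimes>\<^bsub>C_sphere \<epsilon>\<^esub> sphere_gen \<epsilon> j = sphere_gen \<epsilon> j \<otimes>\<^bsub>C_sphere \<epsilon>\<^esub> sphere_gen \<epsilon> i \<longleftrightarrow>
      sphere_gen \<epsilon>' i \<otimes>\<^bsub>C_sphere \<epsilon>'\<^esub> sphere_gen \<epsilon>' j = sphere_gen \<epsilon>' j \<otimes>\<^bsub>C_sphere \<epsilon>'\<^esub> sphere_gen \<epsilon>' i"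
    using inj_on_eq_iff[OF inj] by (simp add: m[symmetric] mult_in_carrier sphere_gen_in_carrier)
  then show False
    using ij by (simp add: sphere_gen_commute_iff \<epsilon> \<epsilon>')
qed

text \<open>The relations for \<open>\<epsilon>\<close> are among those for
  \<open>\<epsilon>'\<close>, and the commutator of \<open>x_i\<close> and \<open>x_j\<close> is
  nonzero in the first algebra but zero in the second.\<close>

lemma quotient_map:
  assumes \<epsilon>: "eps_matrix \<epsilon>" and sub: "\<And>i j. \<epsilon> $ i $ j = 1 \<Longrightarrow> \<epsilon>' $ i $ j = 1"
    and ij: "i \<noteq> j" "\<epsilon> $ i $ j \<noteq> 1" "\<epsilon>' $ i $ j = 1"
  shows "\<exists>\<phi>\<in>star_hom (C_sphere \<epsilon>) (C_sphere \<epsilon>').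
           (\<forall>i. \<phi> (sphere_gen \<epsilon> i) = sphere_gen \<epsilon>' i) \<and>
           \<phi> ` carrier (C_sphere \<epsilon>) = carrier (C_sphere \<epsilon>') \<and>
           \<not> inj_on \<phi> (carrier (C_sphere \<epsilon>))"
proof -
  have "sphere_relations \<epsilon> \<subseteq> sphere_relations \<epsilon>'"
    using sub unfolding sphere_relations_def by blast
  then interpret cstar_pair "sphere_seminorm \<epsilon>" "sphere_seminorm \<epsilon>'"
    by unfold_locales (rule sphere_seminorm_mono)
  have "sphere_seminorm \<epsilon>' (gen i * gen j - gen j * gen i) = 0"
    using ij by (intro sphere_seminorm_relation) (auto simp: sphere_relations_def)
  then have "\<not> inj_on (completion_map (sphere_seminorm \<epsilon>')) (carrier (C_sphere \<epsilon>))"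
    unfolding C_sphere_eq by (rule completion_map_not_inj[OF commutator_nonzero[OF \<epsilon> ij(1,2)]])
  then show ?thesis
    using completion_map_hom completion_map_surj
    by (intro bexI[of _ "completion_map (sphere_seminorm \<epsilon>')"])
      (auto simp: C_sphere_eq sphere_gen_eq completion_map_class)
qed

lemma eps_matrix_comm: "eps_matrix eps_comm"
  by (simp add: eps_matrix_def eps_comm_def)

lemma eps_matrix_free: "eps_matrix eps_free"
  by (simp add: eps_matrix_def eps_free_def)

theorem theorem2p1:
  fixes \<epsilon> \<epsilon>' :: "nat ^ 'n::finite ^ 'n"
  assumes "eps_matrix \<epsilon>" and "eps_matrix \<epsilon>'"
  shows
    "(\<epsilon> \<noteq> eps_comm \<longrightarrow> \<not> commutative_alg (C_sphere \<epsilon>)) \<and>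
     (\<epsilon> \<noteq> \<epsilon>' \<longrightarrow>
        \<not> (\<exists>\<phi>\<in>star_iso (C_sphere \<epsilon>) (C_sphere \<epsilon>').
              \<forall>i. \<phi> (sphere_gen \<epsilon> i) = sphere_gen \<epsilon>' i)) \<and>
     (\<epsilon> \<noteq> eps_comm \<and> \<epsilon> \<noteq> eps_free \<longrightarrow>
        (\<exists>\<phi>\<in>star_hom (C_sphere eps_free) (C_sphere \<epsilon>).
           (\<forall>i. \<phi> (sphere_gen eps_free i) = sphere_gen \<epsilon> i) \<and>
           \<phi> ` carrier (C_sphere eps_free) = carrier (C_sphere \<epsilon>) \<and>
           \<not> inj_on \<phi> (carrier (C_sphere eps_free))) \<and>
        (\<exists>\<psi>\<in>star_hom (C_sphere \<epsilon>) (C_sphere eps_comm).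
           (\<forall>i. \<psi> (sphere_gen \<epsilon> i) = sphere_gen eps_comm i) \<and>
           \<psi> ` carrier (C_sphere \<epsilon>) = carrier (C_sphere eps_comm) \<and>
           \<not> inj_on \<psi> (carrier (C_sphere \<epsilon>))))"
proof (intro conjI impI)
  \<comment> \<open>All off-diagonal entries of \<open>eps_comm\<close> are 1, so at a differing
    position the entry of \<open>\<epsilon>\<close> is not 1.\<close>
  have noncomm: "\<exists>i j. i \<noteq> j \<and> \<epsilon> $ i $ j \<noteq> 1" if nc: "\<epsilon> \<noteq> eps_comm"
  proof -
    obtain i j where "i \<noteq> j" "(\<epsilon> $ i $ j = 1) \<noteq> (eps_comm $ i $ j = (1 :: nat))"
      using eps_matrix_neqE[OF assms(1) eps_matrix_comm nc] by blast
    then show ?thesis by (intro exI[of _ i] exI[of _ j]) (auto simp: eps_comm_def)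
  qed
  {
    assume "\<epsilon> \<noteq> eps_comm"
    then obtain i j where "i \<noteq> j" "\<epsilon> $ i $ j \<noteq> 1" using noncomm by blast
    then show "\<not> commutative_alg (C_sphere \<epsilon>)"
      using sphere_gen_commute_iff[OF assms(1)] sphere_gen_in_carrier
      unfolding commutative_alg_def by blast
  next
    assume "\<epsilon> \<noteq> \<epsilon>'"
    then show "\<not> (\<exists>\<phi>\<in>star_iso (C_sphere \<epsilon>) (C_sphere \<epsilon>'). \<forall>i. \<phi> (sphere_gen \<epsilon> i) = sphere_gen \<epsilon>' i)"
      using no_star_iso[OF assms] by blast
  next
    assume "\<epsilon> \<noteq> eps_comm \<and> \<epsilon> \<noteq> eps_free"
    then obtain i j where "i \<noteq> j" "(\<epsilon> $ i $ j = 1) \<noteq> (eps_free $ i $ j = (1 :: nat))"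
      using eps_matrix_neqE[OF assms(1) eps_matrix_free] by blast
    then show "\<exists>\<phi>\<in>star_hom (C_sphere eps_free) (C_sphere \<epsilon>).
           (\<forall>i. \<phi> (sphere_gen eps_free i) = sphere_gen \<epsilon> i) \<and>
           \<phi> ` carrier (C_sphere eps_free) = carrier (C_sphere \<epsilon>) \<and>
           \<not> inj_on \<phi> (carrier (C_sphere eps_free))"
      by (intro quotient_map[of _ _ i j] eps_matrix_free) (auto simp: eps_free_def)
  next
    assume "\<epsilon> \<noteq> eps_comm \<and> \<epsilon> \<noteq> eps_free"
    then obtain i j where "i \<noteq> j" "\<epsilon> $ i $ j \<noteq> 1" using noncomm by blast
    moreover have "eps_comm $ k $ l = 1" if "\<epsilon> $ k $ l = 1" for k l
      using that assms(1) by (auto simp: eps_comm_def eps_matrix_def)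
    ultimately show "\<exists>\<psi>\<in>star_hom (C_sphere \<epsilon>) (C_sphere eps_comm).
           (\<forall>i. \<psi> (sphere_gen \<epsilon> i) = sphere_gen eps_comm i) \<and>
           \<psi> ` carrier (C_sphere \<epsilon>) = carrier (C_sphere eps_comm) \<and>
           \<not> inj_on \<psi> (carrier (C_sphere \<epsilon>))"
      by (intro quotient_map[of _ _ i j] assms(1)) (auto simp: eps_comm_def)
  }
qed

end
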